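(* Let $0<\sigma_{\min}<1$, $A>0$, $p\ge2$, $\kappa_1,\kappa_2\in\Phi_{\sigma_{\min}}$, and let $h\in C^1(\mathbb{R})$, not identically zero, satisfy, for all $t\in\mathbb{R}$, $|h(t)|\le \frac{\psi_h(t)}{1+|t|}$ and $|h'(t)|\le\frac{\varphi_h(t)}{1+t^2}$, where $\psi_h,\varphi_h$ are continuous, non-negative and bounded functions on $\mathbb{R}$. For $i=1,2$, let $\sigma_{f,\kappa_i,p}$ be the entropic focus function computed with reference focus function $\kappa_i$ and regularization parameter $r=r_i:=r_{\min}(\kappa_i)$. Then, for any $f\in L^2(\mathbb{R})$, $f\ne0$, $$\|\sigma_{f,\kappa_2,p}-\sigma_{f,\kappa_1,p}\|_\infty\le C_3\,\frac{A\,p}{p-1}\,\|\kappa_2-\kappa_1\|_\infty,$$ for some constant $C_3=C_3(p,\|\kappa_1\|_\infty,\|\kappa_2\|_\infty,h,\|u\|_p)$ which, for the fixed parameters $\sigma_{\min}$ and $A$, depends only on the listed quantities (in particular not on $f$).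
   Context: For $0<\sigma_{\min}<1$, $\Phi_{\sigma_{\min}}$ denotes the class of continuous functions $\sigma:\mathbb{R}\to\mathbb{R}$ with $\sigma(t)\ge\sigma_{\min}$ for all $t$ and $\sigma(t)\to1$ as $t\to\pm\infty$. For $\kappa\in\Phi_{\sigma_{\min}}$ put $h_{t,\omega,\kappa}(x)=\sqrt{\kappa(t)}\,e^{2i\pi\omega x}\,h(\kappa(t)(x-t))$ and $\mathcal{L}_\kappa f(t,\omega)=\langle f,h_{t,\omega,\kappa}\rangle$, where $\langle f,g\rangle=\int_{\mathbb{R}}f\,\overline{g}$. Let $u:\mathbb{R}\to[0,\infty)$ be a fixed smooth function with $\int_{\mathbb{R}}u=1$ and $u\in L^p(\mathbb{R})$. For $r>0$ define $$\rho^r_{f,\kappa}(t,\omega)=\frac{|\mathcal{L}_\kappa f(t,\omega)|^2+r\|f\|_2^2\,u(\omega)}{\|\mathcal{L}_\kappa f(t,\cdot)\|_2^2+r\|f\|_2^2}.$$ The Rényi entropy of a probability density $\rho$ on $\mathbb{R}$ is $R_p[\rho]=\frac{1}{1-p}\ln\|\rho\|_p^p$. Put $g_{f,\kappa,p}(t)=R_p[\rho^r_{f,\kappa}(t,\cdot)]$ and define the entropic focus function (with regularization parameter $r$) $$\sigma_{f,\kappa,p}(t)=1+A\left[g_{f,\kappa,p}(t)-\frac{p}{1-p}\ln\|u\|_p\right].$$ Finally $$r_{\min}(\kappa)=\frac{A\,p}{(p-1)(1-\sigma_{\min})}\;\frac{\|\kappa\|_\infty^{1-1/p}\,\|h\|_\infty^{2/p}\,\|h\|_2^{2-2/p}}{\|u\|_p}.$$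 $\|\cdot\|_p$ is the $L^p(\mathbb{R})$ norm. *)

theory Defs
  imports "HOL-Analysis.Analysis" "HOL-Probability.Essential_Supremum"
begin

text \<open>
  Elements of \<open>L\<^sup>p(\<real>)\<close> are given by Borel representatives. The Bochner integral of a
  non-integrable function is 0, so \<open>lp_norm\<close> is the norm only for functions in \<open>L\<^sup>p\<close>.
\<close>

definition in_lp :: "real \<Rightarrow> (real \<Rightarrow> 'a::real_normed_vector) \<Rightarrow> bool" where
  "in_lp p f \<longleftrightarrow> f \<in> borel_measurable lborel \<and> integrable lborel (\<lambda>x. norm (f x) powr p)"

definition lp_norm :: "real \<Rightarrow> (real \<Rightarrow> 'a::real_normed_vector) \<Rightarrow> real" where
  "lp_norm p f = (\<integral>x. norm (f x) powr p \<partial>lborel) powr (1 / p)"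

text \<open>
  The extended-real version is \<open>\<infinity>\<close> for essentially unbounded (and for non-measurable)
  functions; the real version is meant for essentially bounded functions only.
\<close>

definition linf_enorm :: "(real \<Rightarrow> 'a::real_normed_vector) \<Rightarrow> ereal" where
  "linf_enorm f = esssup lborel (\<lambda>x. ereal (norm (f x)))"

definition linf_norm :: "(real \<Rightarrow> 'a::real_normed_vector) \<Rightarrow> real" where
  "linf_norm f = real_of_ereal (linf_enorm f)"

definition l2_inner :: "(real \<Rightarrow> complex) \<Rightarrow> (real \<Rightarrow> complex) \<Rightarrow> complex" where
  "l2_inner f g = (\<integral>x. f x * cnj (g x) \<partial>lborel)"

definition Phi :: "real \<Rightarrow> (real \<Rightarrow> real) set" where
  "Phi \<sigma>min = {\<sigma>. continuous_on UNIV \<sigma> \<and> (\<forall>t. \<sigma> t \<ge> \<sigma>min) \<and>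
     (\<sigma> \<longlongrightarrow> 1) at_top \<and> (\<sigma> \<longlongrightarrow> 1) at_bot}"

definition smooth :: "(real \<Rightarrow> real) \<Rightarrow> bool" where
  "smooth u \<longleftrightarrow> (\<forall>n. (deriv ^^ n) u differentiable_on UNIV)"

definition window_atom ::
  "(real \<Rightarrow> complex) \<Rightarrow> (real \<Rightarrow> real) \<Rightarrow> real \<Rightarrow> real \<Rightarrow> real \<Rightarrow> complex" where
  "window_atom h \<kappa> t \<omega> x =
     of_real (sqrt (\<kappa> t)) * exp (2 * \<i> * of_real pi * of_real \<omega> * of_real x) * h (\<kappa> t * (x - t))"

definition transform ::
  "(real \<Rightarrow> complex) \<Rightarrow> (real \<Rightarrow> real) \<Rightarrow> (real \<Rightarrow> complex) \<Rightarrow> real \<Rightarrow> real \<Rightarrow> complex" where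
  "transform h \<kappa> f t \<omega> = l2_inner f (window_atom h \<kappa> t \<omega>)"

definition rho ::
  "(real \<Rightarrow> complex) \<Rightarrow> (real \<Rightarrow> real) \<Rightarrow> real \<Rightarrow> (real \<Rightarrow> complex) \<Rightarrow> (real \<Rightarrow> real) \<Rightarrow>
    real \<Rightarrow> real \<Rightarrow> real" where
  "rho h u r f \<kappa> t \<omega> =
     ((norm (transform h \<kappa> f t \<omega>))\<^sup>2 + r * (lp_norm 2 f)\<^sup>2 * u \<omega>) /
     ((lp_norm 2 (transform h \<kappa> f t))\<^sup>2 + r * (lp_norm 2 f)\<^sup>2)"

definition renyi_entropy :: "real \<Rightarrow> (real \<Rightarrow> real) \<Rightarrow> real" where
  "renyi_entropy p \<rho> = 1 / (1 - p) * ln (lp_norm p \<rho> powr p)"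

definition focus_function ::
  "real \<Rightarrow> (real \<Rightarrow> complex) \<Rightarrow> (real \<Rightarrow> real) \<Rightarrow> real \<Rightarrow> (real \<Rightarrow> complex) \<Rightarrow> (real \<Rightarrow> real) \<Rightarrow>
    real \<Rightarrow> real \<Rightarrow> real" where
  "focus_function A h u r f \<kappa> p t =
     1 + A * (renyi_entropy p (rho h u r f \<kappa> t) - p / (1 - p) * ln (lp_norm p u))"

definition r_min ::
  "real \<Rightarrow> real \<Rightarrow> (real \<Rightarrow> complex) \<Rightarrow> (real \<Rightarrow> real) \<Rightarrow> real \<Rightarrow> (real \<Rightarrow> real) \<Rightarrow> real" where
  "r_min \<sigma>min A h u p \<kappa> =
     A * p / ((p - 1) * (1 - \<sigma>min)) *
     (linf_norm \<kappa> powr (1 - 1 / p) * linf_norm h powr (2 / p) * lp_norm 2 h powr (2 - 2 / p) /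
      lp_norm p u)"

end

theory Submission
  imports Defs "HOL-Probability.Characteristic_Functions" "HOL-Probability.Sinc_Integral"
    "HOL-Real_Asymp.Real_Asymp"
begin

text \<open>
  After scaling to \<open>\<parallel>f\<parallel>\<^sub>2 = 1\<close>, the transform at time \<open>t\<close> is the Fourier transform of
  \<open>F\<^sub>\<kappa> x = f x \<sqrt>\<kappa>(t) cnj (h (\<kappa>(t) (x - t)))\<close>. The decay of \<open>h\<close> and \<open>h'\<close> gives
  \<open>|F\<^sub>\<kappa>\<^sub>2 x - F\<^sub>\<kappa>\<^sub>1 x| \<le> C |\<kappa>\<^sub>2(t) - \<kappa>\<^sub>1(t)| |f x| / (1 + \<sigma>min |x - t|)\<close>, so the two transforms are
  uniformly and, by Plancherel's inequality, \<open>L\<^sup>2\<close>-close. Interpolation makes their squared moduli close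
  in \<open>L\<^sup>p\<close>. The focus functions differ by a constant times the difference of \<open>ln \<parallel>\<rho>\<parallel>\<^sub>p\<close>, and the
  regularization keeps numerator and denominator of \<open>\<rho>\<close> away from zero, where \<open>ln\<close> is Lipschitz.
\<close>

section \<open>Plancherel's inequality\<close>

text \<open>Plancherel enters only through upper bounds on L^2 norms, and the products
  \<open>F\<^sub>\<kappa>\<close> lie in both L^1 and L^2, so a one-sided inequality for absolutely
  convergent Fourier integrals carries the argument. The weight 1 / (1 + \<sigma>min |x - t|) does
  two jobs: it is square integrable with an integral independent of t, which against f in L^2
  controls the L^1 norm and hence the transform uniformly; and it is at most 1, which controls the
  L^2 norm. Two points shape the constants. The regularization parameter itself moves with the
  reference, so its change must also be charged to the distance of the references, and the
  logarithms are estimated with the smaller of the two parameters. Moreover the final constant may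
  see the references only through their norms and the window only through h, so it has to be
  assembled as a function of exactly these data.\<close>

lemma borel_measurable_cnj [measurable (raw)]:
  "f \<in> borel_measurable M \<Longrightarrow> (\<lambda>x. cnj (f x)) \<in> borel_measurable M"
  by (rule borel_measurable_continuous_on[of cnj]) (auto intro: continuous_intros)

text \<open>The sign and the 2 pi in the exponent match a conjugated \<open>window_atom\<close>, so
  \<open>transform\<close> is an instance without rescaling.\<close>

definition fourier :: "(real \<Rightarrow> complex) \<Rightarrow> real \<Rightarrow> complex" where
  "fourier G \<omega> = (\<integral>x. G x * exp (- (2 * \<i> * of_real pi * of_real \<omega> * of_real x)) \<partial>lborel)"

lemma norm_fourier_kernel [simp]:
  "norm (exp (- (2 * \<i> * of_real pi * of_real \<omega> * of_real x))) = 1" for \<omega> x :: real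
  by (simp add: norm_exp_eq_Re)

text \<open>Up to rescaling this is the characteristic function of the standard normal law. The
  value is recorded as a normal density because its total mass 1 is what matters later.\<close>

lemma fourier_gaussian:
  fixes a s :: real
  assumes "0 < a"
  shows "fourier (\<lambda>\<omega>. of_real (exp (- (\<omega>\<^sup>2) / (2 * a\<^sup>2)))) s = of_real (normal_density 0 (1 / (2 * pi * a)) s)"
proof -
  \<comment> \<open>Chosen so that after the substitution by \<open>x / a\<close> the phase
    \<open>t * (x / a)\<close> equals \<open>- 2 * pi * s * x\<close>.\<close>
  define t where "t = - 2 * pi * a * s"
  have "(\<integral>x. std_normal_density x *\<^sub>R iexp (t * x) \<partial>lborel) = char std_normal_distribution t"
    unfolding char_def by (subst integral_density) auto
  also have "\<dots> = of_real (exp (- (t\<^sup>2) / 2))"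
    by (simp add: char_std_normal_distribution)
  finally have 1: "(\<integral>x. std_normal_density x *\<^sub>R iexp (t * x) \<partial>lborel) = of_real (exp (- (t\<^sup>2) / 2))" .
  have "(\<integral>x. std_normal_density x *\<^sub>R iexp (t * x) \<partial>lborel) =
    (1 / a) *\<^sub>R (\<integral>x. std_normal_density (x / a) *\<^sub>R iexp (t * (x / a)) \<partial>lborel)"
    using assms by (subst lborel_integral_real_affine[where c = "1 / a" and t = 0]) auto
  also have "(\<lambda>x. std_normal_density (x / a) *\<^sub>R iexp (t * (x / a))) =
    (\<lambda>x. of_real (1 / sqrt (2 * pi)) *
       (of_real (exp (- (x\<^sup>2) / (2 * a\<^sup>2))) * exp (- (2 * \<i> * of_real pi * of_real s * of_real x))))"
  proof
    fix x
    have "t * (x / a) = - 2 * pi * s * x" using assms by (simp add: t_def)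
    then show "std_normal_density (x / a) *\<^sub>R iexp (t * (x / a)) =
       of_real (1 / sqrt (2 * pi)) *
       (of_real (exp (- (x\<^sup>2) / (2 * a\<^sup>2))) * exp (- (2 * \<i> * of_real pi * of_real s * of_real x)))"
      by (simp add: std_normal_density_def scaleR_conv_of_real power_divide mult_ac)
  qed
  finally have "(1 / a) *\<^sub>R (of_real (1 / sqrt (2 * pi)) * fourier (\<lambda>\<omega>. of_real (exp (- (\<omega>\<^sup>2) / (2 * a\<^sup>2)))) s)
      = (of_real (exp (- (t\<^sup>2) / 2)) :: complex)"
    unfolding fourier_def 1 by (simp add: mult_ac)
  then have "fourier (\<lambda>\<omega>. of_real (exp (- (\<omega>\<^sup>2) / (2 * a\<^sup>2)))) s =
      of_real (a * sqrt (2 * pi) * exp (- (t\<^sup>2) / 2))"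
    using assms by (simp add: scaleR_conv_of_real field_simps)
  also have "a * sqrt (2 * pi) * exp (- (t\<^sup>2) / 2) = normal_density 0 (1 / (2 * pi * a)) s"
  proof -
    have "sqrt (2 * pi * (1 / (2 * pi * a))\<^sup>2) = sqrt (2 * pi) * (1 / (2 * pi * a))"
      using assms by (simp only: real_sqrt_mult real_sqrt_abs) simp
    moreover have "1 / (q * (1 / (q * q * a))) = a * q" if "q > 0" for q
      using assms that by (simp add: field_simps)
    from this[of "sqrt (2 * pi)"] have "1 / (sqrt (2 * pi) * (1 / (2 * pi * a))) = a * sqrt (2 * pi)"
      by simp
    ultimately have "1 / sqrt (2 * pi * (1 / (2 * pi * a))\<^sup>2) = a * sqrt (2 * pi)"
      by metis
    moreover have "- (t\<^sup>2) / 2 = - (s - 0)\<^sup>2 / (2 * (1 / (2 * pi * a))\<^sup>2)"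
      using assms by (simp add: t_def field_simps power2_eq_square)
    ultimately show ?thesis by (simp add: normal_density_def)
  qed
  finally show ?thesis .
qed

lemma borel_measurable_fourier [measurable]:
  assumes [measurable]: "G \<in> borel_measurable borel"
  shows "fourier G \<in> borel_measurable borel"
  unfolding fourier_def by measurable

lemma norm_fourier_le: "norm (fourier G \<omega>) \<le> (\<integral>x. norm (G x) \<partial>lborel)"
  unfolding fourier_def
  by (rule order_trans[OF integral_norm_bound]) (simp add: norm_mult)

lemma integrable_fourier_integrand:
  assumes "integrable lborel G"
  shows "integrable lborel (\<lambda>x. G x * exp (- (2 * \<i> * of_real pi * of_real \<omega> * of_real x)))"
proof -
  note [measurable] = borel_measurable_integrable[OF assms]
  show ?thesis
    by (rule Bochner_Integration.integrable_bound[OF assms]) (auto simp: norm_mult)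
qed

lemma fourier_diff:
  assumes "integrable lborel F" "integrable lborel G"
  shows "fourier (\<lambda>x. F x - G x) \<omega> = fourier F \<omega> - fourier G \<omega>"
  unfolding fourier_def left_diff_distrib
  by (rule Bochner_Integration.integral_diff) (intro integrable_fourier_integrand assms)+

text \<open>The multiplication formula: Fubini applies because the kernel has modulus 1, and the
  transform changes sides because the kernel is symmetric in \<open>\<omega>\<close> and
  \<open>x\<close>.\<close>

lemma fourier_mult_swap:
  assumes "integrable lborel F" "integrable lborel G"
  shows "(\<integral>\<omega>. F \<omega> * fourier G \<omega> \<partial>lborel) = (\<integral>x. fourier F x * G x \<partial>lborel)"
proof -
  note [measurable] = borel_measurable_integrable[OF assms(1)] borel_measurable_integrable[OF assms(2)]
  let ?e = "\<lambda>\<omega> x :: real. exp (- (2 * \<i> * of_real pi * of_real \<omega> * of_real x))"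
  have "integrable (lborel \<Otimes>\<^sub>M lborel) (\<lambda>(\<omega>, x). F \<omega> * (G x * ?e \<omega> x))"
  proof (rule lborel_pair.Fubini_integrable)
    show "integrable lborel (\<lambda>\<omega>. \<integral>x. norm (case (\<omega>, x) of (\<omega>, x) \<Rightarrow> F \<omega> * (G x * ?e \<omega> x)) \<partial>lborel)"
      using assms by (simp add: norm_mult)
    show "AE \<omega> in lborel. integrable lborel (\<lambda>x. case (\<omega>, x) of (\<omega>, x) \<Rightarrow> F \<omega> * (G x * ?e \<omega> x))"
      using assms by (simp add: integrable_fourier_integrand)
  qed measurable
  from lborel_pair.Fubini_integral[OF this]
  have "(\<integral>\<omega>. (\<integral>x. F \<omega> * (G x * ?e \<omega> x) \<partial>lborel) \<partial>lborel) =
        (\<integral>x. (\<integral>\<omega>. F \<omega> * (G x * ?e \<omega> x) \<partial>lborel) \<partial>lborel)" by simp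
  also have "\<dots> = (\<integral>x. (\<integral>\<omega>. (F \<omega> * ?e x \<omega>) * G x \<partial>lborel) \<partial>lborel)"
    by (simp add: mult_ac)
  finally show ?thesis unfolding fourier_def by simp
qed

lemma fourier_modulate:
  "fourier (\<lambda>x. G x * exp (2 * \<i> * of_real pi * of_real \<eta> * of_real x)) \<omega> = fourier G (\<omega> - \<eta>)"
  unfolding fourier_def by (simp add: mult.assoc exp_add[symmetric] algebra_simps)

text \<open>The Bochner integral of a non-integrable function is 0, so the bound is unconditional
  and inner integrals can be estimated without proving convergence first.\<close>

lemma norm_integral_le_nn_integral:
  fixes f :: "'a \<Rightarrow> 'b::{banach, second_countable_topology}"
  shows "ennreal (norm (integral\<^sup>L M f)) \<le> (\<integral>\<^sup>+x. ennreal (norm (f x)) \<partial>M)"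
  by (cases "integrable M f") (auto simp: integral_norm_bound_ennreal not_integrable_integral_eq)

text \<open>The weight makes the frequency side absolutely integrable, so the multiplication formula
  yields a double integral of k(x - y) cnj (G y) G x with \<open>k\<close> a probability density.
  The bound then follows from |G x| |G y| \<le> (|G x|^2 + |G y|^2) / 2 and mass 1 of
  \<open>k\<close> in either variable.\<close>

lemma gaussian_weighted_plancherel:
  fixes a :: real
  assumes a: "0 < a" and G: "integrable lborel G" and G2: "integrable lborel (\<lambda>x. (norm (G x))\<^sup>2)"
  shows "(\<integral>\<omega>. exp (- (\<omega>\<^sup>2) / (2 * a\<^sup>2)) * (norm (fourier G \<omega>))\<^sup>2 \<partial>lborel) \<le> (\<integral>x. (norm (G x))\<^sup>2 \<partial>lborel)"
proof -
  have [measurable]: "G \<in> borel_measurable borel"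
    using borel_measurable_integrable[OF G] by simp
  define w where "w \<omega> = (of_real (exp (- (\<omega>\<^sup>2) / (2 * a\<^sup>2))) :: complex)" for \<omega>
  define k where "k = normal_density 0 (1 / (2 * pi * a))"
  have [measurable]: "w \<in> borel_measurable borel" "k \<in> borel_measurable borel"
    unfolding w_def k_def by measurable
  have k0: "0 \<le> k s" for s by (simp add: k_def)
  have ik: "integrable lborel k" and ik1: "(\<integral>s. k s \<partial>lborel) = 1"
    using a unfolding k_def by (auto intro!: integrable_normal_density integral_normal_density)
  have "w = (\<lambda>x. of_real (sqrt (2 * pi * a\<^sup>2) * normal_density 0 a x))"
    using a unfolding w_def normal_density_def by (auto simp: real_sqrt_mult)
  then have iw: "integrable lborel w" using a by auto
  have fw: "fourier w s = of_real (k s)" for s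
    unfolding w_def[abs_def] k_def by (rule fourier_gaussian[OF a])
  have iw2: "integrable lborel (\<lambda>\<omega>. w \<omega> * cnj (fourier G \<omega>))"
    by (rule Bochner_Integration.integrable_bound[OF integrable_mult_left[OF iw, of "of_real (\<integral>x. norm (G x) \<partial>lborel)"]])
       (auto simp: norm_mult intro!: mult_left_mono order_trans[OF norm_fourier_le])
  \<comment> \<open>Conjugation turns the transform at \<open>x\<close> into a modulation of the
    Gaussian, which \<open>fourier_modulate\<close> converts into a shift of \<open>k\<close>: the
    result is the convolution of \<open>k\<close> with \<open>cnj G\<close>.\<close>
  have inner: "fourier (\<lambda>\<omega>. w \<omega> * cnj (fourier G \<omega>)) x = (\<integral>y. of_real (k (x - y)) * cnj (G y) \<partial>lborel)" for x
  proof -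
    have "fourier (\<lambda>\<omega>. w \<omega> * cnj (fourier G \<omega>)) x =
       cnj (\<integral>\<omega>. (w \<omega> * exp (2 * \<i> * of_real pi * of_real x * of_real \<omega>)) * fourier G \<omega> \<partial>lborel)"
      unfolding fourier_def[of _ x] Bochner_Integration.integral_cnj[symmetric]
      by (intro Bochner_Integration.integral_cong) (auto simp: w_def exp_cnj)
    also have "(\<integral>\<omega>. (w \<omega> * exp (2 * \<i> * of_real pi * of_real x * of_real \<omega>)) * fourier G \<omega> \<partial>lborel) =
       (\<integral>y. fourier (\<lambda>\<omega>. w \<omega> * exp (2 * \<i> * of_real pi * of_real x * of_real \<omega>)) y * G y \<partial>lborel)"
    proof (rule fourier_mult_swap[OF _ G])
      show "integrable lborel (\<lambda>\<omega>. w \<omega> * exp (2 * \<i> * of_real pi * of_real x * of_real \<omega>))"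
        by (rule Bochner_Integration.integrable_bound[OF iw]) (auto simp: norm_mult norm_exp_eq_Re)
    qed
    also have "cnj \<dots> = (\<integral>y. of_real (k (y - x)) * cnj (G y) \<partial>lborel)"
      unfolding fourier_modulate fw Bochner_Integration.integral_cnj[symmetric] by simp
    also have "\<dots> = (\<integral>y. of_real (k (x - y)) * cnj (G y) \<partial>lborel)"
      by (simp add: k_def normal_density_def power2_commute)
    finally show ?thesis .
  qed
  have "of_real (\<integral>\<omega>. exp (- (\<omega>\<^sup>2) / (2 * a\<^sup>2)) * (norm (fourier G \<omega>))\<^sup>2 \<partial>lborel) =
     (\<integral>\<omega>. (w \<omega> * cnj (fourier G \<omega>)) * fourier G \<omega> \<partial>lborel)"
    unfolding integral_complex_of_real[symmetric]
    by (intro Bochner_Integration.integral_cong) (auto simp: w_def complex_norm_square[unfolded of_real_power] mult_ac simp del: of_real_exp)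
  also have "\<dots> = (\<integral>x. (\<integral>y. of_real (k (x - y)) * cnj (G y) \<partial>lborel) * G x \<partial>lborel)"
    by (simp add: fourier_mult_swap[OF iw2 G] inner)
  finally have eq: "of_real (\<integral>\<omega>. exp (- (\<omega>\<^sup>2) / (2 * a\<^sup>2)) * (norm (fourier G \<omega>))\<^sup>2 \<partial>lborel) =
     (\<integral>x. (\<integral>y. of_real (k (x - y)) * cnj (G y) \<partial>lborel) * G x \<partial>lborel)" .
  \<comment> \<open>The rest runs in \<open>ennreal\<close>, where exchanging integrals and
    splitting sums require only measurability.\<close>
  let ?g = "\<lambda>x. ennreal ((norm (G x))\<^sup>2)"
  have kx: "(\<integral>\<^sup>+y. ennreal (k (x - y)) \<partial>lborel) = 1" for x
  proof -
    have "(\<integral>\<^sup>+y. ennreal (k y) \<partial>lborel) = (\<integral>\<^sup>+y. ennreal (k (x - y)) \<partial>lborel)"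
      by (subst nn_integral_real_affine[where c = "-1" and t = x]) auto
    then show ?thesis using nn_integral_eq_integral[OF ik] k0 ik1 by simp
  qed
  have ky: "(\<integral>\<^sup>+x. ennreal (k (x - y)) \<partial>lborel) = 1" for y
    using kx[of y] by (simp add: k_def normal_density_def power2_commute)
  have sw: "(\<integral>\<^sup>+x. (\<integral>\<^sup>+y. ennreal (k (x - y)) * ?g y \<partial>lborel) \<partial>lborel) = (\<integral>\<^sup>+y. (\<integral>\<^sup>+x. ennreal (k (x - y)) * ?g y \<partial>lborel) \<partial>lborel)"
    by (subst lborel_pair.Fubini') (auto simp: case_prod_beta)
  have A: "(\<integral>\<^sup>+x. (\<integral>\<^sup>+y. ennreal (k (x - y)) * ?g x \<partial>lborel) \<partial>lborel) = (\<integral>\<^sup>+x. ?g x \<partial>lborel)"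
    by (simp add: nn_integral_multc kx)
  have B: "(\<integral>\<^sup>+x. (\<integral>\<^sup>+y. ennreal (k (x - y)) * ?g y \<partial>lborel) \<partial>lborel) = (\<integral>\<^sup>+x. ?g x \<partial>lborel)"
    unfolding sw by (simp add: nn_integral_multc ky)
  have "ennreal (\<integral>\<omega>. exp (- (\<omega>\<^sup>2) / (2 * a\<^sup>2)) * (norm (fourier G \<omega>))\<^sup>2 \<partial>lborel) \<le>
     ennreal (norm (\<integral>x. (\<integral>y. of_real (k (x - y)) * cnj (G y) \<partial>lborel) * G x \<partial>lborel))"
    unfolding eq[symmetric] by (intro ennreal_leI) simp
  also have "\<dots> \<le> (\<integral>\<^sup>+x. ennreal (norm (\<integral>y. of_real (k (x - y)) * cnj (G y) \<partial>lborel)) * ennreal (norm (G x)) \<partial>lborel)"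
    by (rule order_trans[OF norm_integral_le_nn_integral]) (simp add: norm_mult ennreal_mult)
  also have "\<dots> \<le> (\<integral>\<^sup>+x. (\<integral>\<^sup>+y. ennreal (1 / 2) * (ennreal (k (x - y)) * ?g x + ennreal (k (x - y)) * ?g y) \<partial>lborel) \<partial>lborel)"
  proof (rule nn_integral_mono)
    fix x
    have "ennreal (norm (\<integral>y. of_real (k (x - y)) * cnj (G y) \<partial>lborel)) * ennreal (norm (G x)) \<le>
      (\<integral>\<^sup>+y. ennreal (norm (of_real (k (x - y)) * cnj (G y))) \<partial>lborel) * ennreal (norm (G x))"
      by (intro mult_right_mono norm_integral_le_nn_integral) auto
    also have "\<dots> = (\<integral>\<^sup>+y. ennreal (norm (of_real (k (x - y)) * cnj (G y))) * ennreal (norm (G x)) \<partial>lborel)"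
      by (rule nn_integral_multc[symmetric]) auto
    also have "\<dots> \<le> (\<integral>\<^sup>+y. ennreal (1 / 2) * (ennreal (k (x - y)) * ?g x + ennreal (k (x - y)) * ?g y) \<partial>lborel)"
    proof (rule nn_integral_mono)
      fix y
      have "norm (of_real (k (x - y)) * cnj (G y)) * norm (G x) = k (x - y) * (norm (G y) * norm (G x))"
        using k0[of "x - y"] by (simp add: norm_mult)
      also have "\<dots> \<le> k (x - y) * (1 / 2 * ((norm (G x))\<^sup>2 + (norm (G y))\<^sup>2))"
        using sum_squares_bound[of "norm (G x)" "norm (G y)"]
        by (intro mult_left_mono k0) (simp add: mult_ac)
      also have "\<dots> = 1 / 2 * (k (x - y) * (norm (G x))\<^sup>2 + k (x - y) * (norm (G y))\<^sup>2)"
        by (simp add: algebra_simps)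
      finally show "ennreal (norm (of_real (k (x - y)) * cnj (G y))) * ennreal (norm (G x)) \<le>
        ennreal (1 / 2) * (ennreal (k (x - y)) * ?g x + ennreal (k (x - y)) * ?g y)"
        using k0[of "x - y"] by (simp only: ennreal_mult[symmetric] ennreal_plus[symmetric] norm_ge_zero zero_le_power2 mult_nonneg_nonneg add_nonneg_nonneg) (intro ennreal_leI, simp)
    qed
    finally show "ennreal (norm (\<integral>y. of_real (k (x - y)) * cnj (G y) \<partial>lborel)) * ennreal (norm (G x)) \<le>
      (\<integral>\<^sup>+y. ennreal (1 / 2) * (ennreal (k (x - y)) * ?g x + ennreal (k (x - y)) * ?g y) \<partial>lborel)" .
  qed
  also have "\<dots> = ennreal (1 / 2) * ((\<integral>\<^sup>+x. ?g x \<partial>lborel) + (\<integral>\<^sup>+x. ?g x \<partial>lborel))"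
    unfolding A[symmetric] by (simp add: nn_integral_cmult nn_integral_add B A)
  also have "(\<integral>\<^sup>+x. ?g x \<partial>lborel) = ennreal (\<integral>x. (norm (G x))\<^sup>2 \<partial>lborel)"
    by (rule nn_integral_eq_integral[OF G2]) simp
  also have "ennreal (1 / 2) * (ennreal (\<integral>x. (norm (G x))\<^sup>2 \<partial>lborel) + ennreal (\<integral>x. (norm (G x))\<^sup>2 \<partial>lborel)) =
     ennreal (\<integral>x. (norm (G x))\<^sup>2 \<partial>lborel)"
  proof -
    have "ennreal (1 / 2) * (ennreal c + ennreal c) = ennreal c" if "0 \<le> c" for c
    proof -
      have "ennreal c + ennreal c = ennreal (2 * c)"
        using that by (simp flip: ennreal_plus)
      then have "ennreal (1 / 2) * (ennreal c + ennreal c) = ennreal (1 / 2 * (2 * c))"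
        using that by (simp only: ennreal_mult mult_nonneg_nonneg zero_le_numeral)
      then show ?thesis by simp
    qed
    then show ?thesis by simp
  qed
  finally show ?thesis by (simp add: ennreal_le_iff)
qed

text \<open>As their width grows, the Gaussian weights tend to 1 pointwise, while the weighted bound
  does not depend on the width. Fatou's lemma passes to the limit and gives integrability at the
  same time.\<close>

lemma plancherel_le:
  assumes G: "integrable lborel G" and G2: "integrable lborel (\<lambda>x. (norm (G x))\<^sup>2)"
  shows "integrable lborel (\<lambda>\<omega>. (norm (fourier G \<omega>))\<^sup>2)"
    and "(\<integral>\<omega>. (norm (fourier G \<omega>))\<^sup>2 \<partial>lborel) \<le> (\<integral>x. (norm (G x))\<^sup>2 \<partial>lborel)"
proof -
  have [measurable]: "G \<in> borel_measurable borel"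
    using borel_measurable_integrable[OF G] by simp
  define w where "w n \<omega> = exp (- (\<omega>\<^sup>2) / (2 * (real (Suc n))\<^sup>2))" for n \<omega>
  have lim: "(\<lambda>n. w n \<omega>) \<longlonglongrightarrow> 1" for \<omega>
    unfolding w_def by real_asymp
  have le: "(\<integral>\<^sup>+\<omega>. ennreal (w n \<omega> * (norm (fourier G \<omega>))\<^sup>2) \<partial>lborel) \<le> ennreal (\<integral>x. (norm (G x))\<^sup>2 \<partial>lborel)" for n
  proof -
    have "w n = (\<lambda>x. sqrt (2 * pi * (real (Suc n))\<^sup>2) * normal_density 0 (real (Suc n)) x)"
      unfolding w_def normal_density_def by (auto simp: real_sqrt_mult)
    then have iw: "integrable lborel (w n)" by auto
    have "integrable lborel (\<lambda>\<omega>. w n \<omega> * (norm (fourier G \<omega>))\<^sup>2)"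
      by (rule Bochner_Integration.integrable_bound[OF integrable_mult_left[OF iw, of "(\<integral>x. norm (G x) \<partial>lborel)\<^sup>2"]])
         (auto simp: w_def abs_mult intro!: mult_left_mono power_mono norm_fourier_le)
    then have "(\<integral>\<^sup>+\<omega>. ennreal (w n \<omega> * (norm (fourier G \<omega>))\<^sup>2) \<partial>lborel) = ennreal (\<integral>\<omega>. w n \<omega> * (norm (fourier G \<omega>))\<^sup>2 \<partial>lborel)"
      by (rule nn_integral_eq_integral) (simp add: w_def)
    also have "\<dots> \<le> ennreal (\<integral>x. (norm (G x))\<^sup>2 \<partial>lborel)"
      unfolding w_def by (intro ennreal_leI gaussian_weighted_plancherel G G2) simp
    finally show ?thesis .
  qed
  have "(\<integral>\<^sup>+\<omega>. ennreal ((norm (fourier G \<omega>))\<^sup>2) \<partial>lborel) =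
    (\<integral>\<^sup>+\<omega>. liminf (\<lambda>n. ennreal (w n \<omega> * (norm (fourier G \<omega>))\<^sup>2)) \<partial>lborel)"
  proof (rule nn_integral_cong)
    fix \<omega>
    have "(\<lambda>n. ennreal (w n \<omega> * (norm (fourier G \<omega>))\<^sup>2)) \<longlonglongrightarrow> ennreal (1 * (norm (fourier G \<omega>))\<^sup>2)"
      by (intro tendsto_intros lim)
    then show "ennreal ((norm (fourier G \<omega>))\<^sup>2) = liminf (\<lambda>n. ennreal (w n \<omega> * (norm (fourier G \<omega>))\<^sup>2))"
      by (simp add: lim_imp_Liminf)
  qed
  also have "\<dots> \<le> liminf (\<lambda>n. \<integral>\<^sup>+\<omega>. ennreal (w n \<omega> * (norm (fourier G \<omega>))\<^sup>2) \<partial>lborel)"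
    unfolding w_def by (rule nn_integral_liminf) measurable
  also have "\<dots> \<le> ennreal (\<integral>x. (norm (G x))\<^sup>2 \<partial>lborel)"
    by (rule order_trans[OF Liminf_mono[OF always_eventually[OF allI[OF le]]]]) (simp add: Liminf_const)
  finally have *: "(\<integral>\<^sup>+\<omega>. ennreal ((norm (fourier G \<omega>))\<^sup>2) \<partial>lborel) \<le> ennreal (\<integral>x. (norm (G x))\<^sup>2 \<partial>lborel)" .
  show i: "integrable lborel (\<lambda>\<omega>. (norm (fourier G \<omega>))\<^sup>2)"
    by (rule integrableI_nonneg) (use * in \<open>auto intro: le_less_trans\<close>)
  show "(\<integral>\<omega>. (norm (fourier G \<omega>))\<^sup>2 \<partial>lborel) \<le> (\<integral>x. (norm (G x))\<^sup>2 \<partial>lborel)"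
    using * nn_integral_eq_integral[OF i] by (simp add: ennreal_le_iff)
qed

section \<open>The \<open>L\<^sup>p\<close> norm\<close>

lemma in_lp_measurable: "in_lp p f \<Longrightarrow> f \<in> borel_measurable borel"
  by (simp add: in_lp_def)

lemma lp_norm_nonneg [simp]: "0 \<le> lp_norm p f"
  by (simp add: lp_norm_def)

lemma lp_norm_powr:
  assumes "0 < p"
  shows "lp_norm p f powr p = (\<integral>x. norm (f x) powr p \<partial>lborel)"
  using assms by (simp add: lp_norm_def powr_powr)

lemma lp_norm_le_iff:
  assumes "0 < p" "0 \<le> c"
  shows "lp_norm p f \<le> c \<longleftrightarrow> (\<integral>x. norm (f x) powr p \<partial>lborel) \<le> c powr p"
  unfolding lp_norm_powr[OF assms(1), symmetric]
  using assms by (metis lp_norm_nonneg not_le order_less_imp_le powr_less_mono2 powr_mono2)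

lemma in_lp_bound:
  assumes "0 < p" "in_lp p g" "f \<in> borel_measurable borel" "\<And>x. norm (f x) \<le> norm (g x)"
  shows "in_lp p f" "lp_norm p f \<le> lp_norm p g"
proof -
  have *: "norm (f x) powr p \<le> norm (g x) powr p" for x
    using assms by (intro powr_mono2) auto
  note [measurable] = assms(3)
  have i: "integrable lborel (\<lambda>x. norm (g x) powr p)"
    using assms(2) by (simp add: in_lp_def)
  have "integrable lborel (\<lambda>x. norm (f x) powr p)"
    by (rule Bochner_Integration.integrable_bound[OF i]) (use * in auto)
  then show "in_lp p f" by (simp add: in_lp_def)
  show "lp_norm p f \<le> lp_norm p g"
    unfolding lp_norm_def using assms(1)
    by (intro powr_mono2 integral_mono'[OF i *]) auto
qed

lemma in_lp_scale:
  fixes f :: "real \<Rightarrow> 'a::{real_normed_div_algebra, second_countable_topology}"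
  assumes "in_lp p f"
  shows "in_lp p (\<lambda>x. c * f x)"
  using assms by (auto simp: in_lp_def norm_mult powr_mult)

lemma lp_norm_scale:
  fixes f :: "real \<Rightarrow> 'a::real_normed_div_algebra"
  assumes "0 < p"
  shows "lp_norm p (\<lambda>x. c * f x) = norm c * lp_norm p f"
  using assms by (simp add: lp_norm_def norm_mult powr_mult powr_powr)

text \<open>Convexity of \<open>powr\<close> settles positive arguments; if one of them vanishes,
  the claim reduces to \<open>c powr p \<le> c\<close> for 0 < c < 1.\<close>

lemma powr_convex_combination:
  fixes x y l p :: real
  assumes "1 \<le> p" "0 \<le> x" "0 \<le> y" "0 < l" "l < 1"
  shows "(l * x + (1 - l) * y) powr p \<le> l * x powr p + (1 - l) * y powr p"
proof -
  have m: "(c * z) powr p \<le> c * z powr p" if "0 < c" "c < 1" "0 \<le> z" for c z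
  proof -
    have "c powr p \<le> c powr 1" using that assms by (intro powr_mono') auto
    then show ?thesis using that by (simp add: powr_mult mult_right_mono)
  qed
  show ?thesis
  proof (cases "x = 0 \<or> y = 0")
    case True
    then show ?thesis using m[of l x] m[of "1 - l" y] assms by auto
  next
    case False
    then show ?thesis
      using convex_onD[OF powr_convex[OF assms(1)], of "1 - l" x y] assms by auto
  qed
qed

text \<open>Minkowski's inequality from convexity: for positive bounds \<alpha>, \<beta> on the two
  norms, the sum is \<alpha> + \<beta> times a convex combination of f / \<alpha> and g / \<beta>
  with weights proportional to \<alpha> and \<beta>.\<close>

lemma lp_norm_triangle:
  fixes f g :: "real \<Rightarrow> 'a::{real_normed_vector, second_countable_topology}"
  assumes p: "1 \<le> p" and f: "in_lp p f" and g: "in_lp p g"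
  shows "in_lp p (\<lambda>x. f x + g x)" "lp_norm p (\<lambda>x. f x + g x) \<le> lp_norm p f + lp_norm p g"
proof -
  have [measurable]: "f \<in> borel_measurable borel" "g \<in> borel_measurable borel"
    using f g by (auto simp: in_lp_def)
  note fi = f[unfolded in_lp_def, THEN conjunct2] and gi = g[unfolded in_lp_def, THEN conjunct2]
  \<comment> \<open>Strictly positive bounds instead of the norms themselves keep the divisions
    legitimate when a norm is 0; the slack \<open>e\<close> introduced for this is removed at the
    end.\<close>
  have *: "in_lp p (\<lambda>x. f x + g x) \<and> lp_norm p (\<lambda>x. f x + g x) \<le> \<alpha> + \<beta>"
    if \<alpha>: "lp_norm p f \<le> \<alpha>" "0 < \<alpha>" and \<beta>: "lp_norm p g \<le> \<beta>" "0 < \<beta>" for \<alpha> \<beta>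
  proof -
    define l where "l = \<alpha> / (\<alpha> + \<beta>)"
    have l: "0 < l" "l < 1" "1 - l = \<beta> / (\<alpha> + \<beta>)"
      using \<alpha> \<beta> by (auto simp: l_def field_simps)
    define F where "F x = (\<alpha> + \<beta>) powr p * (l * (norm (f x) powr p / \<alpha> powr p) + (1 - l) * (norm (g x) powr p / \<beta> powr p))" for x
    have iF: "integrable lborel F"
      unfolding F_def by (intro integrable_mult_right Bochner_Integration.integrable_add integrable_divide fi gi)
    have div: "s * (\<alpha> / s * (x / \<alpha>) + \<beta> / s * (y / \<beta>)) = x + y" if "0 < s" for s x y
      using \<alpha> \<beta> that by (simp add: field_simps)
    have le: "norm (f x + g x) powr p \<le> F x" for x
    proof -
      have "norm (f x + g x) powr p \<le> (norm (f x) + norm (g x)) powr p"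
        using p by (intro powr_mono2 norm_triangle_ineq) auto
      also have "norm (f x) + norm (g x) = (\<alpha> + \<beta>) * (l * (norm (f x) / \<alpha>) + (1 - l) * (norm (g x) / \<beta>))"
        unfolding l(3) unfolding l_def using \<alpha> \<beta> by (intro div[symmetric]) simp
      also have "\<dots> powr p = (\<alpha> + \<beta>) powr p * (l * (norm (f x) / \<alpha>) + (1 - l) * (norm (g x) / \<beta>)) powr p"
        using \<alpha> \<beta> l by (intro powr_mult) 
      also have "\<dots> \<le> (\<alpha> + \<beta>) powr p * (l * (norm (f x) / \<alpha>) powr p + (1 - l) * (norm (g x) / \<beta>) powr p)"
        using \<alpha> \<beta> l p by (intro mult_left_mono powr_convex_combination) auto
      also have "\<dots> = F x"
        using \<alpha> \<beta> by (simp add: F_def powr_divide)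
      finally show ?thesis .
    qed
    have i: "integrable lborel (\<lambda>x. norm (f x + g x) powr p)"
      by (rule Bochner_Integration.integrable_bound[OF iF]) (auto intro!: AE_I2 order_trans[OF le abs_ge_self])
    have "(\<integral>x. norm (f x + g x) powr p \<partial>lborel) \<le> (\<integral>x. F x \<partial>lborel)"
      by (rule integral_mono[OF i iF le])
    also have "\<dots> = (\<alpha> + \<beta>) powr p * (l * ((\<integral>x. norm (f x) powr p \<partial>lborel) / \<alpha> powr p)
        + (1 - l) * ((\<integral>x. norm (g x) powr p \<partial>lborel) / \<beta> powr p))"
      unfolding F_def using fi gi by simp
    also have "\<dots> \<le> (\<alpha> + \<beta>) powr p * (l * 1 + (1 - l) * 1)"
      using \<alpha> \<beta> l p lp_norm_le_iff[of p \<alpha> f] lp_norm_le_iff[of p \<beta> g]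
      by (intro mult_left_mono add_mono) auto
    finally show ?thesis
      using \<alpha> \<beta> p i by (subst lp_norm_le_iff) (auto simp: in_lp_def)
  qed
  have **: "in_lp p (\<lambda>x. f x + g x) \<and> lp_norm p (\<lambda>x. f x + g x) \<le> lp_norm p f + lp_norm p g + e" if "0 < e" for e
    using *[of "lp_norm p f + e / 2" "lp_norm p g + e / 2"] that
      lp_norm_nonneg[of p f] lp_norm_nonneg[of p g] by (simp add: add_ac add_pos_nonneg add_nonneg_pos)
  then show "in_lp p (\<lambda>x. f x + g x)" using zero_less_one by blast
  show "lp_norm p (\<lambda>x. f x + g x) \<le> lp_norm p f + lp_norm p g"
    by (rule field_le_epsilon) (use ** in blast)
qed

text \<open>Interpolation between the uniform and the L^2 bound. Here \<open>e\<close> is the small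
  factor and \<open>s\<close> a majorant of size \<open>m\<close> in both senses, so |g|^p \<le> e^p
  m^(p-2) s^2; p \<ge> 2 makes the exponent of \<open>m\<close> non-negative.\<close>

lemma lp_norm_interpolate:
  fixes g s :: "real \<Rightarrow> real"
  assumes p: "2 \<le> p" and [measurable]: "g \<in> borel_measurable borel"
    and g: "\<And>x. \<bar>g x\<bar> \<le> e * s x" and s: "\<And>x. 0 \<le> s x" "\<And>x. s x \<le> m"
    and si: "integrable lborel (\<lambda>x. (s x)\<^sup>2)" "(\<integral>x. (s x)\<^sup>2 \<partial>lborel) \<le> m\<^sup>2" and e: "0 \<le> e" and m: "0 < m"
  shows "in_lp p g" "lp_norm p g \<le> e * m"
proof -
  define F where "F x = e powr p * m powr (p - 2) * (s x)\<^sup>2" for x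
  have le: "\<bar>g x\<bar> powr p \<le> F x" for x
  proof -
    have "\<bar>g x\<bar> powr p \<le> (e * s x) powr p"
      using p g by (intro powr_mono2) auto
    also have "\<dots> = e powr p * s x powr p"
      using e s by (simp add: powr_mult)
    also have "s x powr p = s x powr (p - 2) * s x powr 2"
      by (simp flip: powr_add)
    also have "s x powr 2 = (s x)\<^sup>2"
      using s by (cases "s x = 0") (auto simp: powr_numeral)
    also have "e powr p * (s x powr (p - 2) * (s x)\<^sup>2) \<le> e powr p * (m powr (p - 2) * (s x)\<^sup>2)"
      using s p by (intro mult_left_mono mult_right_mono powr_mono2) auto
    finally show ?thesis by (simp add: F_def mult_ac)
  qed
  have iF: "integrable lborel F" unfolding F_def using si by simp
  have i: "integrable lborel (\<lambda>x. \<bar>g x\<bar> powr p)"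
    by (rule Bochner_Integration.integrable_bound[OF iF]) (auto intro!: AE_I2 order_trans[OF le abs_ge_self])
  then show "in_lp p g" by (simp add: in_lp_def)
  have "(\<integral>x. \<bar>g x\<bar> powr p \<partial>lborel) \<le> (\<integral>x. F x \<partial>lborel)"
    by (rule integral_mono[OF i iF le])
  also have "\<dots> \<le> e powr p * m powr (p - 2) * m\<^sup>2"
    unfolding F_def using si by (simp add: mult_left_mono)
  also have "\<dots> = e powr p * (m powr (p - 2) * m powr 2)"
    using m by (simp add: powr_numeral)
  also have "m powr (p - 2) * m powr 2 = m powr p"
    by (simp flip: powr_add)
  also have "e powr p * m powr p = (e * m) powr p"
    using e m by (simp add: powr_mult)
  finally show "lp_norm p g \<le> e * m"
    using p e m by (subst lp_norm_le_iff) auto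
qed

lemma abs_ln_diff_le:
  fixes x y :: real
  assumes "0 < m" "m \<le> x" "m \<le> y"
  shows "\<bar>ln x - ln y\<bar> \<le> \<bar>x - y\<bar> / m"
proof -
  have *: "ln x - ln y \<le> \<bar>x - y\<bar> / m" if "m \<le> x" "m \<le> y" for x y
  proof -
    have "ln x - ln y \<le> (x - y) / y" using that assms(1) by (intro ln_diff_le) auto
    also have "\<dots> \<le> \<bar>x - y\<bar> / y" using that assms(1) by (intro divide_right_mono) auto
    also have "\<dots> \<le> \<bar>x - y\<bar> / m" using that assms(1) by (intro divide_left_mono) auto
    finally show ?thesis .
  qed
  show ?thesis using *[OF assms(2,3)] *[OF assms(3,2)] by (auto simp: abs_le_iff abs_minus_commute)
qed

section \<open>Stability of regularized densities\<close>

text \<open>By homogeneity the logarithm of the norm splits into that of the numerator's norm minus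
  that of the total mass. In the constant, \<open>2 * M * K + L * lp_norm p u\<close> measures the
  change of the numerators in L^p, divided by their lower bound \<open>r * lp_norm p u\<close>; the
  second summand does the same for the total masses, which are at least \<open>r\<close>.\<close>

lemma regularized_density_lipschitz:
  fixes a b :: "real \<Rightarrow> complex" and u :: "real \<Rightarrow> real"
  assumes p: "2 \<le> p" and u0: "\<And>x. 0 \<le> u x" and u: "in_lp p u" and U: "0 < lp_norm p u"
    and [measurable]: "a \<in> borel_measurable borel" "b \<in> borel_measurable borel"
    and a: "\<And>x. norm (a x) \<le> M" "integrable lborel (\<lambda>x. (norm (a x))\<^sup>2)" "(\<integral>x. (norm (a x))\<^sup>2 \<partial>lborel) \<le> M\<^sup>2"
    and b: "\<And>x. norm (b x) \<le> M" "integrable lborel (\<lambda>x. (norm (b x))\<^sup>2)" "(\<integral>x. (norm (b x))\<^sup>2 \<partial>lborel) \<le> M\<^sup>2"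
    and ab: "\<And>x. norm (a x - b x) \<le> K * d" "integrable lborel (\<lambda>x. (norm (a x - b x))\<^sup>2)"
      "(\<integral>x. (norm (a x - b x))\<^sup>2 \<partial>lborel) \<le> (K * d)\<^sup>2"
    and r: "0 < r" "r \<le> r1" "r \<le> r2" "\<bar>r1 - r2\<bar> \<le> L * d"
    and pos: "0 \<le> d" "0 \<le> K" "0 < M"
  shows "\<bar>ln (lp_norm p (\<lambda>x. ((norm (a x))\<^sup>2 + r1 * u x) / ((\<integral>x. (norm (a x))\<^sup>2 \<partial>lborel) + r1)))
        - ln (lp_norm p (\<lambda>x. ((norm (b x))\<^sup>2 + r2 * u x) / ((\<integral>x. (norm (b x))\<^sup>2 \<partial>lborel) + r2)))\<bar>
      \<le> ((2 * M * K + L * lp_norm p u) / (r * lp_norm p u) + ((K\<^sup>2 + 4 * M\<^sup>2) / 2 + L) / r) * d"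
proof -
  have [measurable]: "u \<in> borel_measurable borel" using u by (simp add: in_lp_def)
  let ?U = "lp_norm p u" and ?A = "\<integral>x. (norm (a x))\<^sup>2 \<partial>lborel" and ?B = "\<integral>x. (norm (b x))\<^sup>2 \<partial>lborel"
  define X where "X c s = lp_norm p (\<lambda>x. (norm (c x))\<^sup>2 + s * u x)" for c :: "real \<Rightarrow> complex" and s
  have p0: "0 < p" "1 \<le> p" using p by auto
  have sq: "in_lp p (\<lambda>x. (norm (c x))\<^sup>2)"
    if "c \<in> borel_measurable borel" "\<And>x. norm (c x) \<le> M" "integrable lborel (\<lambda>x. (norm (c x))\<^sup>2)"
      "(\<integral>x. (norm (c x))\<^sup>2 \<partial>lborel) \<le> M\<^sup>2" for c :: "real \<Rightarrow> complex"
    using that pos by (intro lp_norm_interpolate(1)[OF p, of _ M "\<lambda>x. norm (c x)" M])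
      (auto simp: power2_eq_square intro: mult_right_mono)
  have Xin: "in_lp p (\<lambda>x. (norm (c x))\<^sup>2 + s * u x)"
    if "in_lp p (\<lambda>x. (norm (c x))\<^sup>2)" for c :: "real \<Rightarrow> complex" and s
    by (intro lp_norm_triangle(1)[OF p0(2)] that in_lp_scale u)
  have Xge: "r * ?U \<le> X c s" if "in_lp p (\<lambda>x. (norm (c x))\<^sup>2)" "r \<le> s" for c :: "real \<Rightarrow> complex" and s
  proof -
    have "r * ?U = lp_norm p (\<lambda>x. r * u x)" using r p0 by (simp add: lp_norm_scale)
    also have "\<dots> \<le> X c s"
      unfolding X_def using p0(1) Xin[OF that(1)]
    proof (rule in_lp_bound(2))
      fix x
      have "r * u x \<le> s * u x" using that u0 by (intro mult_right_mono) auto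
      then have "r * u x \<le> (norm (c x))\<^sup>2 + s * u x" by (simp add: add_increasing)
      then show "norm (r * u x) \<le> norm ((norm (c x))\<^sup>2 + s * u x)"
        using r u0[of x] by (simp add: abs_mult)
    qed simp
    finally show ?thesis .
  qed
  define D where "D x = \<bar>(norm (a x))\<^sup>2 - (norm (b x))\<^sup>2\<bar>" for x
  have Dle: "D x \<le> norm (a x - b x) * (norm (a x) + norm (b x))" for x
  proof -
    have "D x = \<bar>norm (a x) - norm (b x)\<bar> * (norm (a x) + norm (b x))"
      by (simp add: D_def power2_eq_square square_diff_square_factored abs_mult mult.commute)
    also have "\<dots> \<le> norm (a x - b x) * (norm (a x) + norm (b x))"
      by (intro mult_right_mono norm_triangle_ineq3) auto
    finally show ?thesis .
  qed
  have [measurable]: "D \<in> borel_measurable borel" unfolding D_def[abs_def] by measurable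
  have s_sq: "(norm (a x) + norm (b x))\<^sup>2 \<le> 2 * (norm (a x))\<^sup>2 + 2 * (norm (b x))\<^sup>2" for x
    using sum_squares_bound[of "norm (a x)" "norm (b x)"] by (simp add: power2_sum)
  have isq: "integrable lborel (\<lambda>x. (norm (a x) + norm (b x))\<^sup>2)"
    by (rule Bochner_Integration.integrable_bound[of _ "\<lambda>x. 2 * (norm (a x))\<^sup>2 + 2 * (norm (b x))\<^sup>2"])
       (use a b s_sq in auto)
  have "(\<integral>x. (norm (a x) + norm (b x))\<^sup>2 \<partial>lborel) \<le> (\<integral>x. 2 * (norm (a x))\<^sup>2 + 2 * (norm (b x))\<^sup>2 \<partial>lborel)"
    using a b by (intro integral_mono isq s_sq) auto
  also have "\<dots> = 2 * ?A + 2 * ?B" using a b by simp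
  also have "\<dots> \<le> 4 * M\<^sup>2" using a b by simp
  finally have isq_le: "(\<integral>x. (norm (a x) + norm (b x))\<^sup>2 \<partial>lborel) \<le> 4 * M\<^sup>2" .
  \<comment> \<open>The factor |a - b| is at most \<open>K * d\<close>, while |a| + |b| has size
    \<open>2 * M\<close> both uniformly and in L^2; these are the \<open>e\<close> and
    \<open>m\<close> of the interpolation.\<close>
  have D: "in_lp p D" "lp_norm p D \<le> K * d * (2 * M)"
  proof -
    have h: "\<bar>D x\<bar> \<le> K * d * (norm (a x) + norm (b x))" for x
      using order_trans[OF Dle mult_right_mono[OF ab(1)]] by (simp add: D_def)
    have "norm (a x) + norm (b x) \<le> 2 * M" for x using a(1)[of x] b(1)[of x] by simp
    moreover have "(\<integral>x. (norm (a x) + norm (b x))\<^sup>2 \<partial>lborel) \<le> (2 * M)\<^sup>2"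
      using isq_le by (simp add: power_mult_distrib)
    ultimately show "in_lp p D" "lp_norm p D \<le> K * d * (2 * M)"
      using lp_norm_interpolate[OF p, of D "K * d" "\<lambda>x. norm (a x) + norm (b x)" "2 * M"] h isq pos by auto
  qed
  \<comment> \<open>Only \<open>D\<close>, which is symmetric in \<open>a\<close> and
    \<open>b\<close>, enters, so exchanging the two pairs yields both halves of the absolute
    value.\<close>
  have dX: "X c s \<le> X c' s' + (K * d * (2 * M) + L * d * ?U)"
    if c: "in_lp p (\<lambda>x. (norm (c x))\<^sup>2)" "in_lp p (\<lambda>x. (norm (c' x))\<^sup>2)"
      and s: "0 \<le> s" "\<bar>s - s'\<bar> \<le> L * d" and D': "\<And>x. \<bar>(norm (c x))\<^sup>2 - (norm (c' x))\<^sup>2\<bar> = D x"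
    for c c' :: "real \<Rightarrow> complex" and s s'
  proof -
    have [measurable]: "(\<lambda>x. (norm (c x))\<^sup>2) \<in> borel_measurable borel"
      by (rule in_lp_measurable[OF c(1)])
    let ?E = "\<lambda>x. D x + \<bar>s - s'\<bar> * u x"
    have E: "in_lp p ?E" "lp_norm p ?E \<le> lp_norm p D + lp_norm p (\<lambda>x. \<bar>s - s'\<bar> * u x)"
      by (intro lp_norm_triangle[OF p0(2) D(1)] in_lp_scale u)+
    have "X c s \<le> lp_norm p (\<lambda>x. ((norm (c' x))\<^sup>2 + s' * u x) + ?E x)"
      unfolding X_def
    proof (rule in_lp_bound(2)[OF p0(1)])
      show "in_lp p (\<lambda>x. ((norm (c' x))\<^sup>2 + s' * u x) + ?E x)"
        by (intro lp_norm_triangle(1)[OF p0(2)] Xin c E)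
      fix x
      have "(s - s') * u x \<le> \<bar>s - s'\<bar> * u x" using u0 by (intro mult_right_mono) auto
      then have "(norm (c x))\<^sup>2 + s * u x \<le> ((norm (c' x))\<^sup>2 + s' * u x) + ?E x"
        using D'[of x] by (simp add: algebra_simps abs_le_iff)
      moreover have "0 \<le> (norm (c x))\<^sup>2 + s * u x" using s u0[of x] by simp
      ultimately show "norm ((norm (c x))\<^sup>2 + s * u x) \<le> norm (((norm (c' x))\<^sup>2 + s' * u x) + ?E x)"
        by simp
    qed measurable
    also have "\<dots> \<le> X c' s' + lp_norm p ?E"
      unfolding X_def by (intro lp_norm_triangle(2)[OF p0(2)] Xin c E)
    also have "lp_norm p ?E \<le> K * d * (2 * M) + \<bar>s - s'\<bar> * ?U"
      using E(2) D(2) p0 by (simp add: lp_norm_scale)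
    also have "\<bar>s - s'\<bar> * ?U \<le> L * d * ?U" using s by (intro mult_right_mono) auto
    finally show ?thesis by simp
  qed
  note ain = sq[OF _ a] and bin = sq[OF _ b]
  have "\<bar>X a r1 - X b r2\<bar> \<le> K * d * (2 * M) + L * d * ?U"
    using dX[of a b r1 r2] dX[of b a r2 r1] ain bin r
    by (simp add: D_def abs_minus_commute abs_le_iff)
  then have 1: "\<bar>ln (X a r1) - ln (X b r2)\<bar> \<le> (K * d * (2 * M) + L * d * ?U) / (r * ?U)"
    using ain bin r U Xge[of a r1] Xge[of b r2]
    by (intro order_trans[OF abs_ln_diff_le[of "r * ?U"]] divide_right_mono) auto
  \<comment> \<open>The weighted inequality x y \<le> (x^2 / d + d y^2) / 2 with x = |a - b|, y =
    |a| + |b| takes the place of Cauchy-Schwarz: the integral of x^2 is of order d^2, so both terms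
    are of order d. Dividing by \<open>d\<close> forces \<open>d = 0\<close>, where a = b, to be
    treated apart.\<close>
  have "\<bar>?A - ?B\<bar> \<le> (K\<^sup>2 + 4 * M\<^sup>2) / 2 * d"
  proof (cases "d = 0")
    case True
    then have "a x = b x" for x using ab(1)[of x] by simp
    then show ?thesis using True by simp
  next
    case False
    then have d: "0 < d" using pos by simp
    have *: "D x \<le> ((norm (a x - b x))\<^sup>2 / d + d * (norm (a x) + norm (b x))\<^sup>2) / 2" for x
    proof -
      have "2 * norm (a x - b x) * (d * (norm (a x) + norm (b x))) \<le> (norm (a x - b x))\<^sup>2 + (d * (norm (a x) + norm (b x)))\<^sup>2"
        by (rule sum_squares_bound)
      moreover have "((norm (a x - b x))\<^sup>2 / d + d * (norm (a x) + norm (b x))\<^sup>2) * d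
          = (norm (a x - b x))\<^sup>2 + (d * (norm (a x) + norm (b x)))\<^sup>2"
        using d by (simp add: distrib_right power_mult_distrib power2_eq_square[of d])
      ultimately have "2 * (norm (a x - b x) * (norm (a x) + norm (b x))) * d
         \<le> ((norm (a x - b x))\<^sup>2 / d + d * (norm (a x) + norm (b x))\<^sup>2) * d"
        by (simp add: mult_ac)
      then show ?thesis using d Dle[of x] by (simp add: mult_le_cancel_right)
    qed
    have "\<bar>?A - ?B\<bar> = \<bar>\<integral>x. (norm (a x))\<^sup>2 - (norm (b x))\<^sup>2 \<partial>lborel\<bar>"
      using a b by simp
    also have "\<dots> \<le> (\<integral>x. D x \<partial>lborel)"
      unfolding D_def by (rule integral_abs_bound)
    also have "\<dots> \<le> (\<integral>x. ((norm (a x - b x))\<^sup>2 / d + d * (norm (a x) + norm (b x))\<^sup>2) / 2 \<partial>lborel)"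
      using ab isq d by (intro integral_mono' *) (auto simp: D_def)
    also have "\<dots> = ((\<integral>x. (norm (a x - b x))\<^sup>2 \<partial>lborel) / d + d * (\<integral>x. (norm (a x) + norm (b x))\<^sup>2 \<partial>lborel)) / 2"
      using ab isq by simp
    also have "\<dots> \<le> ((K * d)\<^sup>2 / d + d * (4 * M\<^sup>2)) / 2"
      using ab isq_le d by (intro divide_right_mono add_mono mult_left_mono) auto
    also have "\<dots> = (K\<^sup>2 + 4 * M\<^sup>2) / 2 * d"
      using d by (simp add: field_simps power2_eq_square)
    finally show ?thesis .
  qed
  then have "\<bar>(?A + r1) - (?B + r2)\<bar> \<le> ((K\<^sup>2 + 4 * M\<^sup>2) / 2 + L) * d"
    using r(4) unfolding distrib_right by linarith
  moreover have "r \<le> ?A + r1" "r \<le> ?B + r2" using r by (auto intro: add_increasing)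
  ultimately have 2: "\<bar>ln (?A + r1) - ln (?B + r2)\<bar> \<le> ((K\<^sup>2 + 4 * M\<^sup>2) / 2 + L) * d / r"
    using r by (intro order_trans[OF abs_ln_diff_le[of r]] divide_right_mono) auto
  have eq: "ln (lp_norm p (\<lambda>x. ((norm (c x))\<^sup>2 + s * u x) / (C + s))) = ln (X c s) - ln (C + s)"
    if "0 < X c s" "0 < C + s" for c :: "real \<Rightarrow> complex" and C s
    using lp_norm_scale[OF p0(1), of "1 / (C + s)" "\<lambda>x. (norm (c x))\<^sup>2 + s * u x"] that
    by (simp add: X_def ln_div)
  have "0 < X a r1" "0 < X b r2"
    using ain bin r less_le_trans[OF mult_pos_pos[OF r(1) U] Xge] by auto
  moreover have "0 < ?A + r1" "0 < ?B + r2"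
    using r by (auto intro: add_nonneg_pos)
  ultimately have e: "\<bar>ln (lp_norm p (\<lambda>x. ((norm (a x))\<^sup>2 + r1 * u x) / (?A + r1)))
      - ln (lp_norm p (\<lambda>x. ((norm (b x))\<^sup>2 + r2 * u x) / (?B + r2)))\<bar>
    = \<bar>(ln (X a r1) - ln (?A + r1)) - (ln (X b r2) - ln (?B + r2))\<bar>"
    by (simp add: eq)
  have "(2 * M * K + L * ?U) * d = K * d * (2 * M) + L * d * ?U"
    by (simp add: algebra_simps)
  moreover have "(x / y + z / w) * d = (x * d) / y + z * d / w" for x y z w
    by (simp add: distrib_right)
  ultimately show ?thesis unfolding e using 1 2 by (simp only:)
qed

section \<open>Windows and the transform\<close>

text \<open>Mean value inequality in the dilation parameter on the convex set
  \<open>{\<sigma>..}\<close>. Differentiating \<open>h (s * y)\<close> produces a growing factor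
  \<open>y\<close>, which the quadratic decay of \<open>D\<close> absorbs, leaving the decay of
  \<open>h\<close>. The constant 5/2 is 1/2 from the derivative of the square root plus 2 from this
  term.\<close>

lemma window_lipschitz:
  fixes h D :: "real \<Rightarrow> 'a::real_normed_vector"
  assumes D: "\<And>t. (h has_vector_derivative D t) (at t)"
    and h: "\<And>t. norm (h t) \<le> B / (1 + \<bar>t\<bar>)" and h': "\<And>t. norm (D t) \<le> B / (1 + t\<^sup>2)"
    and \<sigma>: "0 < \<sigma>" "\<sigma> \<le> s1" "\<sigma> \<le> s2" and B: "0 \<le> B"
  shows "norm (sqrt s2 *\<^sub>R h (s2 * y) - sqrt s1 *\<^sub>R h (s1 * y)) \<le>
    5 / 2 * B / sqrt \<sigma> * \<bar>s2 - s1\<bar> / (1 + \<sigma> * \<bar>y\<bar>)"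
proof -
  define V where "V s = (1 / (2 * sqrt s)) *\<^sub>R h (s * y) + (sqrt s * y) *\<^sub>R D (s * y)" for s
  have "norm (sqrt s2 *\<^sub>R h (s2 * y) - sqrt s1 *\<^sub>R h (s1 * y)) \<le>
      5 / 2 * B / sqrt \<sigma> / (1 + \<sigma> * \<bar>y\<bar>) * norm (s2 - s1)"
  proof (rule differentiable_bound[where S = "{\<sigma>..}" and f' = "\<lambda>s x. x *\<^sub>R V s"])
    fix s assume "s \<in> {\<sigma>..}"
    then have s: "0 < s" "\<sigma> \<le> s" using \<sigma> by auto
    have "((\<lambda>s. s * y) has_vector_derivative y) (at s)"
      by (auto intro!: derivative_eq_intros simp: has_real_derivative_iff_has_vector_derivative[symmetric])
    from vector_diff_chain_at[OF this D] have hy: "((\<lambda>s. h (s * y)) has_vector_derivative y *\<^sub>R D (s * y)) (at s)"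
      by (simp add: o_def)
    have "((\<lambda>s. sqrt s *\<^sub>R h (s * y)) has_vector_derivative V s) (at s)"
      using s unfolding V_def
      by (auto intro!: derivative_eq_intros has_vector_derivative_scaleR hy simp: inverse_eq_divide)
    then show "((\<lambda>s. sqrt s *\<^sub>R h (s * y)) has_derivative (\<lambda>x. x *\<^sub>R V s)) (at s within {\<sigma>..})"
      by (simp add: has_vector_derivative_def has_derivative_at_withinI)
    define z where "z = s * \<bar>y\<bar>"
    have z: "0 \<le> z" "\<sigma> * \<bar>y\<bar> \<le> z" using s by (auto simp: z_def mult_right_mono)
    have 1: "norm ((1 / (2 * sqrt s)) *\<^sub>R h (s * y)) \<le> B / (1 + \<sigma> * \<bar>y\<bar>) / (2 * sqrt \<sigma>)"
    proof -
      have "norm (h (s * y)) \<le> B / (1 + z)"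
        using h[of "s * y"] s by (simp add: z_def abs_mult)
      also have "\<dots> \<le> B / (1 + \<sigma> * \<bar>y\<bar>)"
        using z B \<sigma> by (intro divide_left_mono mult_pos_pos add_pos_nonneg) auto
      finally have "norm (h (s * y)) / (2 * sqrt s) \<le> B / (1 + \<sigma> * \<bar>y\<bar>) / (2 * sqrt \<sigma>)"
        using s \<sigma> B by (intro frac_le) auto
      then show ?thesis using s by simp
    qed
    have 2: "norm ((sqrt s * y) *\<^sub>R D (s * y)) \<le> 2 * B / (1 + \<sigma> * \<bar>y\<bar>) / sqrt \<sigma>"
    proof -
      have "z * norm (D (s * y)) \<le> z * (B / (1 + z\<^sup>2))"
        using h'[of "s * y"] z by (intro mult_left_mono) (auto simp: z_def power_mult_distrib)
      \<comment> \<open>Since 2 z \<le> 1 + z^2, one has z (1 + z) \<le> 2 (1 + z^2); this is the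
        origin of the factor 2.\<close>
      also have "\<dots> \<le> 2 * B / (1 + z)"
      proof -
        have "2 * z \<le> z\<^sup>2 + 1" using sum_squares_bound[of z 1] by simp
        then have "z + z\<^sup>2 \<le> 2 * (1 + z\<^sup>2)" using zero_le_power2[of z] z(1) unfolding distrib_left by linarith
        then have "z * (1 + z) \<le> 2 * (1 + z\<^sup>2)" by (simp add: power2_eq_square distrib_left)
        then have "B * (z * (1 + z)) \<le> B * (2 * (1 + z\<^sup>2))"
          using B by (rule mult_left_mono)
        moreover have "0 < 1 + z\<^sup>2" by (simp add: add_pos_nonneg)
        ultimately show ?thesis using z by (simp add: divide_simps) (simp add: mult_ac)
      qed
      also have "\<dots> \<le> 2 * B / (1 + \<sigma> * \<bar>y\<bar>)"
        using z B \<sigma> by (intro divide_left_mono mult_pos_pos add_pos_nonneg) auto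
      finally have "z * norm (D (s * y)) / sqrt s \<le> 2 * B / (1 + \<sigma> * \<bar>y\<bar>) / sqrt \<sigma>"
        using s \<sigma> B by (intro frac_le) auto
      moreover have "norm ((sqrt s * y) *\<^sub>R D (s * y)) = z * norm (D (s * y)) / sqrt s"
        using s by (simp add: z_def abs_mult real_div_sqrt field_simps)
      ultimately show ?thesis by simp
    qed
    have "norm (V s) \<le> B / (1 + \<sigma> * \<bar>y\<bar>) / (2 * sqrt \<sigma>) + 2 * B / (1 + \<sigma> * \<bar>y\<bar>) / sqrt \<sigma>"
      unfolding V_def by (rule norm_triangle_le[OF add_mono[OF 1 2]])
    also have "\<dots> = 5 / 2 * B / sqrt \<sigma> / (1 + \<sigma> * \<bar>y\<bar>)"
    proof -
      have "B / e / (2 * q) + 2 * B / e / q = 5 / 2 * B / q / e" if "0 < e" "0 < q" for e q :: real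
        using that by (simp add: field_simps)
      then show ?thesis using \<sigma> by (simp add: add_pos_nonneg)
    qed
    finally have "norm (V s) \<le> 5 / 2 * B / sqrt \<sigma> / (1 + \<sigma> * \<bar>y\<bar>)" .
    moreover have "onorm (\<lambda>x. x *\<^sub>R V s) \<le> norm (V s)"
      by (rule onorm_le) (simp add: mult.commute)
    ultimately show "onorm (\<lambda>x. x *\<^sub>R V s) \<le> 5 / 2 * B / sqrt \<sigma> / (1 + \<sigma> * \<bar>y\<bar>)" by simp
  qed (use \<sigma> in auto)
  then show ?thesis by (simp add: mult_ac)
qed

lemma window_bound:
  fixes h :: "real \<Rightarrow> 'a::real_normed_vector"
  assumes h: "\<And>t. norm (h t) \<le> B / (1 + \<bar>t\<bar>)" and \<sigma>: "0 < \<sigma>" "\<sigma> \<le> s" "s \<le> k" and B: "0 \<le> B"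
  shows "norm (sqrt s *\<^sub>R h (s * y)) \<le> sqrt k * B / (1 + \<sigma> * \<bar>y\<bar>)"
proof -
  have "norm (h (s * y)) \<le> B / (1 + s * \<bar>y\<bar>)"
    using h[of "s * y"] \<sigma> by (simp add: abs_mult)
  also have "\<dots> \<le> B / (1 + \<sigma> * \<bar>y\<bar>)"
    using B \<sigma> by (intro divide_left_mono add_left_mono mult_right_mono mult_pos_pos) (auto intro: add_pos_nonneg)
  finally have "sqrt s * norm (h (s * y)) \<le> sqrt k * (B / (1 + \<sigma> * \<bar>y\<bar>))"
    using \<sigma> by (intro mult_mono) auto
  then show ?thesis using \<sigma> by simp
qed

text \<open>Comparison with 1 / (1 + x^2), where 1 + x^2 \<le> (1 + 1 / \<sigma>^2) (1 + \<sigma>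
  |x|)^2; a translation moves the centre to \<open>t\<close>.\<close>

lemma integrable_decay:
  fixes \<sigma> t :: real
  assumes "0 < \<sigma>"
  shows "integrable lborel (\<lambda>x. (1 / (1 + \<sigma> * \<bar>x - t\<bar>))\<^sup>2)"
proof -
  have "integrable lborel (\<lambda>x :: real. (1 + 1 / \<sigma>\<^sup>2) * inverse (1 + x\<^sup>2))"
    using integrable_inverse_1_plus_square by (simp add: set_integrable_def einterval_def)
  then have "integrable lborel (\<lambda>x. (1 / (1 + \<sigma> * \<bar>x\<bar>))\<^sup>2)"
  proof (rule Bochner_Integration.integrable_bound; (intro AE_I2)?)
    fix x :: real
    have p: "0 < 1 + \<sigma> * \<bar>x\<bar>" "0 < 1 + x\<^sup>2" using assms by (auto intro: add_pos_nonneg)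
    have "(1 + 1 / \<sigma>\<^sup>2) * (1 + (\<sigma> * \<bar>x\<bar>)\<^sup>2) = 1 + x\<^sup>2 + (\<sigma>\<^sup>2 * x\<^sup>2 + 1 / \<sigma>\<^sup>2)"
      using assms by (simp add: power_mult_distrib field_simps)
    then have "1 + x\<^sup>2 \<le> (1 + 1 / \<sigma>\<^sup>2) * (1 + (\<sigma> * \<bar>x\<bar>)\<^sup>2)" by simp
    also have "\<dots> \<le> (1 + 1 / \<sigma>\<^sup>2) * (1 + \<sigma> * \<bar>x\<bar>)\<^sup>2"
      using assms by (intro mult_left_mono) (auto simp: power2_sum)
    finally have "1 / (1 + \<sigma> * \<bar>x\<bar>)\<^sup>2 \<le> (1 + 1 / \<sigma>\<^sup>2) / (1 + x\<^sup>2)"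
      using p by (simp add: divide_simps)
    then show "norm ((1 / (1 + \<sigma> * \<bar>x\<bar>))\<^sup>2) \<le> norm ((1 + 1 / \<sigma>\<^sup>2) * inverse (1 + x\<^sup>2))"
      using p by (simp add: power_one_over[symmetric] divide_inverse abs_mult power_inverse)
  qed measurable
  from lborel_integrable_real_affine[OF this, of 1 "- t"] show ?thesis
    by (simp add: algebra_simps)
qed

text \<open>Serves both for each transform and for their difference, where \<open>c\<close> carries
  the distance of the references. The weight and \<open>f\<close> give the L^1 bound
  \<open>c * (I / 2)\<close>; the weight being at most 1 gives the L^2 bound \<open>c\<close>. The
  summand 1 in \<open>I\<close> is the squared norm of \<open>f\<close> and also ensures
  \<open>1 \<le> I\<close>, so the single number \<open>I * c\<close> covers both bounds.\<close>

lemma fourier_decay_bound: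
  fixes f F :: "real \<Rightarrow> complex"
  assumes f: "in_lp 2 f" "lp_norm 2 f = 1"
    and \<sigma>: "0 < \<sigma>" and c: "0 \<le> c" and F[measurable]: "F \<in> borel_measurable borel"
    and Fle: "\<And>x. norm (F x) \<le> c * (norm (f x) * (1 / (1 + \<sigma> * \<bar>x - t\<bar>)))"
  defines "I \<equiv> 1 + (\<integral>x. (1 / (1 + \<sigma> * \<bar>x\<bar>))\<^sup>2 \<partial>lborel)"
  shows "integrable lborel F" and "norm (fourier F \<omega>) \<le> I * c"
    and "integrable lborel (\<lambda>\<omega>. (norm (fourier F \<omega>))\<^sup>2)"
    and "(\<integral>\<omega>. (norm (fourier F \<omega>))\<^sup>2 \<partial>lborel) \<le> (I * c)\<^sup>2"
proof -
  have [measurable]: "f \<in> borel_measurable borel" by (rule in_lp_measurable[OF f(1)])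
  define e where "e x = 1 / (1 + \<sigma> * \<bar>x - t\<bar>)" for x
  have e: "0 \<le> e x" "e x \<le> 1" for x
  proof -
    have "1 \<le> 1 + \<sigma> * \<bar>x - t\<bar>" using \<sigma> by simp
    then show "0 \<le> e x" "e x \<le> 1" by (simp_all add: e_def)
  qed
  have ie: "integrable lborel (\<lambda>x. (e x)\<^sup>2)" unfolding e_def by (rule integrable_decay[OF \<sigma>])
  \<comment> \<open>Translation invariance removes \<open>t\<close>, which makes the estimate
    uniform in time.\<close>
  have I: "I = 1 + (\<integral>x. (e x)\<^sup>2 \<partial>lborel)"
    unfolding I_def e_def
    by (subst (2) lborel_integral_real_affine[where c = 1 and t = t]) auto
  have I1: "1 \<le> I" unfolding I_def by (simp add: integral_nonneg_AE)
  have p2: "norm (f x) powr 2 = (norm (f x))\<^sup>2" for x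
    by (cases "f x = 0") (auto simp: powr_numeral)
  have if2: "integrable lborel (\<lambda>x. (norm (f x))\<^sup>2)" using f(1) by (simp add: in_lp_def p2)
  have if1: "(\<integral>x. (norm (f x))\<^sup>2 \<partial>lborel) = 1"
    using lp_norm_powr[of 2 f] f(2) by (simp add: p2)
  have le: "norm (F x) \<le> c * (((norm (f x))\<^sup>2 + (e x)\<^sup>2) / 2)" for x
    using sum_squares_bound[of "norm (f x)" "e x"]
    by (intro order_trans[OF Fle] mult_left_mono c) (simp add: e_def mult.commute)
  have ib: "integrable lborel (\<lambda>x. c * (((norm (f x))\<^sup>2 + (e x)\<^sup>2) / 2))"
    using if2 ie by simp
  show iF: "integrable lborel F"
  proof (rule Bochner_Integration.integrable_bound[OF ib])
    show "F \<in> borel_measurable lborel" by simp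
    show "AE x in lborel. norm (F x) \<le> norm (c * (((norm (f x))\<^sup>2 + (e x)\<^sup>2) / 2))"
      unfolding real_norm_def by (rule AE_I2[OF order_trans[OF le abs_ge_self]])
  qed
  have "norm (fourier F \<omega>) \<le> (\<integral>x. norm (F x) \<partial>lborel)" by (rule norm_fourier_le)
  also have "\<dots> \<le> (\<integral>x. c * (((norm (f x))\<^sup>2 + (e x)\<^sup>2) / 2) \<partial>lborel)"
    by (rule integral_mono[OF integrable_norm[OF iF] ib le])
  also have "\<dots> = c * (I / 2)" using if2 ie if1 I by simp
  also have "\<dots> \<le> I * c" using c I1 by (simp add: mult.commute mult_right_mono)
  finally show "norm (fourier F \<omega>) \<le> I * c" .
  have le2: "(norm (F x))\<^sup>2 \<le> c\<^sup>2 * (norm (f x))\<^sup>2" for x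
  proof -
    have "norm (F x) \<le> c * (norm (f x) * 1)"
      using e[of x] by (intro order_trans[OF Fle] mult_left_mono c) (auto simp: e_def)
    from power_mono[OF this norm_ge_zero, of 2] show ?thesis by (simp add: power_mult_distrib)
  qed
  have ib2: "integrable lborel (\<lambda>x. c\<^sup>2 * (norm (f x))\<^sup>2)" using if2 by simp
  have iF2: "integrable lborel (\<lambda>x. (norm (F x))\<^sup>2)"
    by (rule Bochner_Integration.integrable_bound[OF ib2]) (auto intro!: AE_I2 order_trans[OF le2])
  show "integrable lborel (\<lambda>\<omega>. (norm (fourier F \<omega>))\<^sup>2)" by (rule plancherel_le(1)[OF iF iF2])
  have "(\<integral>\<omega>. (norm (fourier F \<omega>))\<^sup>2 \<partial>lborel) \<le> (\<integral>x. (norm (F x))\<^sup>2 \<partial>lborel)"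
    by (rule plancherel_le(2)[OF iF iF2])
  also have "\<dots> \<le> (\<integral>x. c\<^sup>2 * (norm (f x))\<^sup>2 \<partial>lborel)" by (rule integral_mono[OF iF2 ib2 le2])
  also have "\<dots> = c\<^sup>2" using if1 by simp
  also have "\<dots> \<le> (I * c)\<^sup>2"
    using I1 c mult_right_mono[OF I1 c] by (intro power_mono) auto
  finally show "(\<integral>\<omega>. (norm (fourier F \<omega>))\<^sup>2 \<partial>lborel) \<le> (I * c)\<^sup>2" .
qed

lemma transform_eq_fourier:
  "transform h \<kappa> f t \<omega> = fourier (\<lambda>x. f x * cnj (sqrt (\<kappa> t) *\<^sub>R h (\<kappa> t * (x - t)))) \<omega>"
  unfolding transform_def l2_inner_def window_atom_def fourier_def
  by (intro Bochner_Integration.integral_cong) (auto simp: exp_cnj scaleR_conv_of_real mult_ac)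

lemma transform_scale:
  "transform h \<kappa> (\<lambda>x. c * f x) t \<omega> = c * transform h \<kappa> f t \<omega>"
  unfolding transform_def l2_inner_def by (simp add: mult.assoc)

text \<open>Numerator and denominator of \<open>rho\<close> are both quadratic in \<open>f\<close>,
  so \<open>(lp_norm 2 f)\<^sup>2\<close> cancels; this keeps \<open>f\<close> out of every
  constant.\<close>

lemma rho_normalize:
  assumes "lp_norm 2 f \<noteq> 0"
  defines "g \<equiv> (\<lambda>x. of_real (1 / lp_norm 2 f) * f x)"
  shows "rho h u r f \<kappa> t \<omega> =
    ((norm (transform h \<kappa> g t \<omega>))\<^sup>2 + r * u \<omega>) /
      ((\<integral>\<omega>. (norm (transform h \<kappa> g t \<omega>))\<^sup>2 \<partial>lborel) + r)"
proof -
  define N where "N = lp_norm 2 f"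
  have N: "0 < N" using assms(1) lp_norm_nonneg[of 2 f] by (simp add: N_def less_le)
  have tr: "(norm (transform h \<kappa> f t \<omega>))\<^sup>2 = N\<^sup>2 * (norm (transform h \<kappa> g t \<omega>))\<^sup>2" for \<omega>
    using N unfolding g_def transform_scale N_def[symmetric]
    by (simp add: norm_mult norm_divide power_divide)
  have p2: "norm z powr 2 = (norm z)\<^sup>2" for z :: complex
    by (cases "z = 0") (auto simp: powr_numeral)
  have "(lp_norm 2 (transform h \<kappa> f t))\<^sup>2 = lp_norm 2 (transform h \<kappa> f t) powr 2"
    by (cases "lp_norm 2 (transform h \<kappa> f t) = 0") (auto simp: powr_numeral less_le)
  also have "\<dots> = N\<^sup>2 * (\<integral>\<omega>. (norm (transform h \<kappa> g t \<omega>))\<^sup>2 \<partial>lborel)"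
    by (subst lp_norm_powr) (auto simp: p2 tr)
  finally show ?thesis
    unfolding rho_def tr N_def[symmetric]
    using N mult_divide_mult_cancel_left[of "N\<^sup>2" "(norm (transform h \<kappa> g t \<omega>))\<^sup>2 + r * u \<omega>"
      "(\<integral>\<omega>. (norm (transform h \<kappa> g t \<omega>))\<^sup>2 \<partial>lborel) + r"]
    by (simp only: distrib_left mult.assoc mult.left_commute[of r] mult.commute[of r "N\<^sup>2"]) simp
qed

section \<open>Essential bounds and measurability in time\<close>

lemma AE_lborel_const: "(AE x in (lborel :: real measure). P) \<longleftrightarrow> P"
proof -
  have "ae_filter (lborel :: real measure) \<noteq> bot"
    by (simp add: ae_filter_eq_bot_iff)
  then show ?thesis by (rule eventually_const)
qed

text \<open>The bound \<open>c\<close> excludes the value \<infinity>, which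
  \<open>real_of_ereal\<close> would turn into a meaningless 0.\<close>

lemma linf_norm_AE:
  assumes [measurable]: "g \<in> borel_measurable borel" and c: "\<And>t. norm (g t) \<le> c"
  shows "AE t in lborel. norm (g t) \<le> linf_norm g" "0 \<le> linf_norm g"
    and "(AE t in lborel. norm (g t) \<le> b) \<Longrightarrow> linf_norm g \<le> b"
proof -
  have ub: "linf_enorm g \<le> ereal c"
    unfolding linf_enorm_def by (rule esssup_I) (auto simp: c)
  have "esssup (lborel :: real measure) (\<lambda>x. 0 :: ereal) \<le> linf_enorm g"
    unfolding linf_enorm_def by (rule esssup_mono) auto
  then have lb: "0 \<le> linf_enorm g" by (subst (asm) esssup_const) auto
  have eq: "ereal (linf_norm g) = linf_enorm g"
    unfolding linf_norm_def using ub lb by (intro ereal_real') auto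
  have "AE t in lborel. ereal (norm (g t)) \<le> ereal (linf_norm g)"
    unfolding eq linf_enorm_def by (rule esssup_AE)
  then show "AE t in lborel. norm (g t) \<le> linf_norm g" by simp
  show "0 \<le> linf_norm g" using lb unfolding eq[symmetric] by simp
  assume "AE t in lborel. norm (g t) \<le> b"
  then have "linf_enorm g \<le> ereal b"
    unfolding linf_enorm_def by (intro esssup_I) auto
  then show "linf_norm g \<le> b" unfolding eq[symmetric] by simp
qed

text \<open>Links a nonzero value of the window to a nonzero class in L^p: by continuity h would be
  nonzero on an interval of positive measure.\<close>

lemma continuous_AE_zeroD:
  fixes h :: "real \<Rightarrow> 'a::real_normed_vector"
  assumes "continuous_on UNIV h" "AE x in lborel. h x = 0"
  shows "h t = 0"
proof (rule ccontr)
  assume "h t \<noteq> 0"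
  have "open {x. h x \<noteq> 0}"
    by (rule open_Collect_neq) (use assms in auto)
  with \<open>h t \<noteq> 0\<close> obtain e where e: "0 < e" "ball t e \<subseteq> {x. h x \<noteq> 0}"
    by (auto simp: open_contains_ball)
  then have sub: "{t <..< t + e} \<subseteq> {x. h x \<noteq> 0}"
    by (auto simp: subset_eq dist_real_def)
  have "AE x in lborel. x \<notin> {t <..< t + e}"
    using assms(2) by eventually_elim (use sub in auto)
  then have "emeasure lborel {t <..< t + e} = 0"
    by (subst (asm) AE_iff_measurable[where N = "{t <..< t + e}"]) auto
  then show False using e by simp
qed

lemma lp_norm_eq_0D:
  assumes "0 < p" "in_lp p f" "lp_norm p f = 0"
  shows "AE x in lborel. f x = 0"
proof -
  have "(\<integral>x. norm (f x) powr p \<partial>lborel) = 0"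
    using lp_norm_powr[OF assms(1), of f] assms by simp
  then have "AE x in lborel. norm (f x) powr p = 0"
    using assms(2) by (subst (asm) integral_nonneg_eq_0_iff_AE) (auto simp: in_lp_def)
  then show ?thesis by simp
qed

lemma Phi_bounded:
  assumes "\<kappa> \<in> Phi \<sigma>min"
  obtains c where "\<And>t. \<bar>\<kappa> t\<bar> \<le> c"
proof -
  have k: "continuous_on UNIV \<kappa>" "(\<kappa> \<longlongrightarrow> 1) at_top" "(\<kappa> \<longlongrightarrow> 1) at_bot"
    using assms by (auto simp: Phi_def)
  have "\<forall>\<^sub>F t in at_top. dist (\<kappa> t) 1 < 1" using k(2) by (rule tendstoD) simp
  then obtain b where b: "\<And>t. t \<ge> b \<Longrightarrow> dist (\<kappa> t) 1 < 1" by (auto simp: eventually_at_top_linorder)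
  have "\<forall>\<^sub>F t in at_bot. dist (\<kappa> t) 1 < 1" using k(3) by (rule tendstoD) simp
  then obtain a where a: "\<And>t. t \<le> a \<Longrightarrow> dist (\<kappa> t) 1 < 1" by (auto simp: eventually_at_bot_linorder)
  have "compact (\<kappa> ` {a..b})"
    by (rule compact_continuous_image) (auto intro: continuous_on_subset[OF k(1)])
  then obtain c where c: "\<And>t. t \<in> {a..b} \<Longrightarrow> \<bar>\<kappa> t\<bar> \<le> c"
    using compact_imp_bounded[of "\<kappa> ` {a..b}"] unfolding bounded_iff by (metis imageI real_norm_def)
  have "\<bar>\<kappa> t\<bar> \<le> max 2 c" for t
    using a[of t] b[of t] c[of t] by (cases "t \<le> a"; cases "t \<ge> b") (auto simp: dist_real_def)
  then show thesis by (rule that)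
qed

lemma Phi_measurable: "\<kappa> \<in> Phi \<sigma>min \<Longrightarrow> \<kappa> \<in> borel_measurable borel"
  by (auto simp: Phi_def intro: borel_measurable_continuous_onI)

lemma Phi_linf_norm:
  assumes "\<kappa> \<in> Phi \<sigma>min"
  shows "AE t in lborel. \<kappa> t \<le> linf_norm \<kappa>" "\<sigma>min \<le> linf_norm \<kappa>"
proof -
  obtain c where "\<And>t. \<bar>\<kappa> t\<bar> \<le> c" by (rule Phi_bounded[OF assms]) blast
  then have "AE t in lborel. norm (\<kappa> t) \<le> linf_norm \<kappa>"
    by (intro linf_norm_AE(1)[OF Phi_measurable[OF assms], of c]) simp
  then show *: "AE t in lborel. \<kappa> t \<le> linf_norm \<kappa>"
    by eventually_elim simp
  have "AE t in (lborel :: real measure). \<sigma>min \<le> linf_norm \<kappa>"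
    using * by eventually_elim (use assms in \<open>auto simp: Phi_def intro: order_trans\<close>)
  then show "\<sigma>min \<le> linf_norm \<kappa>" by (simp only: AE_lborel_const)
qed

text \<open>The reverse triangle inequality in the last part controls the change of
  \<open>r_min\<close>, which sees a reference only through its norm.\<close>

lemma Phi_linf_norm_diff:
  assumes "\<kappa>1 \<in> Phi \<sigma>min" "\<kappa>2 \<in> Phi \<sigma>min"
  shows "AE t in lborel. \<bar>\<kappa>2 t - \<kappa>1 t\<bar> \<le> linf_norm (\<lambda>t. \<kappa>2 t - \<kappa>1 t)"
    and "0 \<le> linf_norm (\<lambda>t. \<kappa>2 t - \<kappa>1 t)"
    and "\<bar>linf_norm \<kappa>2 - linf_norm \<kappa>1\<bar> \<le> linf_norm (\<lambda>t. \<kappa>2 t - \<kappa>1 t)"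
proof -
  note [measurable] = assms[THEN Phi_measurable]
  obtain c1 where c1: "\<And>t. \<bar>\<kappa>1 t\<bar> \<le> c1" by (rule Phi_bounded[OF assms(1)]) blast
  obtain c2 where c2: "\<And>t. \<bar>\<kappa>2 t\<bar> \<le> c2" by (rule Phi_bounded[OF assms(2)]) blast
  have c: "norm (\<kappa>2 t - \<kappa>1 t) \<le> c1 + c2" for t using c1[of t] c2[of t] by simp
  have m: "(\<lambda>t. \<kappa>2 t - \<kappa>1 t) \<in> borel_measurable borel" by measurable
  show 1: "AE t in lborel. \<bar>\<kappa>2 t - \<kappa>1 t\<bar> \<le> linf_norm (\<lambda>t. \<kappa>2 t - \<kappa>1 t)"
    using linf_norm_AE(1)[OF m c] by simp
  show "0 \<le> linf_norm (\<lambda>t. \<kappa>2 t - \<kappa>1 t)" by (rule linf_norm_AE(2)[OF m c])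
  have "linf_norm \<kappa>2 \<le> linf_norm \<kappa>1 + linf_norm (\<lambda>t. \<kappa>2 t - \<kappa>1 t)"
  proof (rule linf_norm_AE(3)[where c = c2])
    have "AE t in lborel. \<bar>\<kappa>1 t\<bar> \<le> linf_norm \<kappa>1"
      using linf_norm_AE(1)[of \<kappa>1 c1] c1 by simp
    with 1 show "AE t in lborel. norm (\<kappa>2 t) \<le> linf_norm \<kappa>1 + linf_norm (\<lambda>t. \<kappa>2 t - \<kappa>1 t)"
      by eventually_elim simp
  qed (use c2 in auto)
  moreover have "linf_norm \<kappa>1 \<le> linf_norm \<kappa>2 + linf_norm (\<lambda>t. \<kappa>2 t - \<kappa>1 t)"
  proof (rule linf_norm_AE(3)[where c = c1])
    have "AE t in lborel. \<bar>\<kappa>2 t\<bar> \<le> linf_norm \<kappa>2"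
      using linf_norm_AE(1)[of \<kappa>2 c2] c2 by simp
    with 1 show "AE t in lborel. norm (\<kappa>1 t) \<le> linf_norm \<kappa>2 + linf_norm (\<lambda>t. \<kappa>2 t - \<kappa>1 t)"
      by eventually_elim simp
  qed (use c1 in auto)
  ultimately show "\<bar>linf_norm \<kappa>2 - linf_norm \<kappa>1\<bar> \<le> linf_norm (\<lambda>t. \<kappa>2 t - \<kappa>1 t)" by linarith
qed

lemma borel_measurable_transform [measurable]:
  assumes [measurable]: "h \<in> borel_measurable borel" "\<kappa> \<in> borel_measurable borel" "f \<in> borel_measurable borel"
  shows "(\<lambda>(t, \<omega>). transform h \<kappa> f t \<omega>) \<in> borel_measurable (borel \<Otimes>\<^sub>M borel)"
  unfolding transform_def l2_inner_def window_atom_def by measurable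

text \<open>The essential supremum of a non-measurable function is \<infinity>, so a pointwise
  estimate becomes a norm estimate only after measurability in time.\<close>

lemma borel_measurable_focus_function [measurable]:
  assumes [measurable]: "h \<in> borel_measurable borel" "\<kappa> \<in> borel_measurable borel"
    "f \<in> borel_measurable borel" "u \<in> borel_measurable borel"
  shows "focus_function A h u r f \<kappa> p \<in> borel_measurable borel"
proof -
  have [measurable]: "(\<lambda>t. lp_norm 2 (transform h \<kappa> f t)) \<in> borel_measurable borel"
    unfolding lp_norm_def by measurable
  have [measurable]: "(\<lambda>(t, \<omega>). rho h u r f \<kappa> t \<omega>) \<in> borel_measurable (borel \<Otimes>\<^sub>M borel)"
    unfolding rho_def by measurable
  show ?thesis
    unfolding focus_function_def[abs_def] renyi_entropy_def lp_norm_def by measurable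
qed

text \<open>Both norms are factors of \<open>r_min\<close>, whose positivity underlies the logarithm
  estimates. The decay bound makes \<open>h\<close> bounded and square integrable, so neither norm
  is a default 0.\<close>

lemma window_norms_pos:
  fixes h :: "real \<Rightarrow> 'a::{real_normed_vector, second_countable_topology}"
  assumes h: "continuous_on UNIV h" "h t0 \<noteq> 0" and B: "\<And>t. norm (h t) \<le> B / (1 + \<bar>t\<bar>)"
  shows "0 < linf_norm h" "0 < lp_norm 2 h"
proof -
  have hm[measurable]: "h \<in> borel_measurable borel" by (rule borel_measurable_continuous_onI[OF h(1)])
  have nz: "\<not> (AE x in lborel. h x = 0)" using continuous_AE_zeroD[OF h(1)] h(2) by blast
  have "0 \<le> B" using order_trans[OF norm_ge_zero B[of 0]] by simp
  then have bd: "norm (h t) \<le> B" for t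
    by (intro order_trans[OF B]) (simp add: divide_le_eq mult_nonneg_nonneg distrib_left)
  have "linf_norm h \<noteq> 0"
  proof
    assume "linf_norm h = 0"
    then have "AE x in lborel. h x = 0" using linf_norm_AE(1)[OF hm bd] by simp
    with nz show False by simp
  qed
  with linf_norm_AE(2)[OF hm bd] show "0 < linf_norm h" by simp
  have "integrable lborel (\<lambda>t :: real. B\<^sup>2 * (1 / (1 + 1 * \<bar>t - 0\<bar>))\<^sup>2)"
    by (intro integrable_mult_right integrable_decay) simp
  then have "integrable lborel (\<lambda>t. norm (h t) powr 2)"
  proof (rule Bochner_Integration.integrable_bound; (intro AE_I2)?)
    fix t
    have "(norm (h t))\<^sup>2 \<le> (B / (1 + \<bar>t\<bar>))\<^sup>2" by (intro power_mono B) simp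
    then show "norm (norm (h t) powr 2) \<le> norm (B\<^sup>2 * (1 / (1 + 1 * \<bar>t - 0\<bar>))\<^sup>2)"
      by (cases "h t = 0") (auto simp: powr_numeral power_divide)
  qed measurable
  then have "in_lp 2 h" by (simp add: in_lp_def)
  then show "0 < lp_norm 2 h"
    using lp_norm_eq_0D[of 2 h] nz lp_norm_nonneg[of 2 h] by (auto simp: less_le)
qed

section \<open>Lipschitz dependence on the reference\<close>

text \<open>The case \<open>lp_norm p \<rho> = 0\<close> is consistent because
  \<open>ln 0 = 0\<close>.\<close>

lemma renyi_entropy_eq:
  assumes "p \<noteq> 0"
  shows "renyi_entropy p \<rho> = p / (1 - p) * ln (lp_norm p \<rho>)"
  unfolding renyi_entropy_def
  using assms by (cases "lp_norm p \<rho> = 0") (auto simp: ln_powr less_le)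

text \<open>The regularization parameters are arbitrary positive numbers coupled by
  \<open>L\<close>. \<open>M\<close> bounds both transforms, and \<open>K\<close> times the distance
  of the references bounds their difference, each uniformly and in L^2. The sum of norms in
  \<open>M\<close> is a common upper bound for both references.\<close>

lemma focus_function_lipschitz:
  fixes \<sigma>min A p B :: real and u \<kappa>1 \<kappa>2 :: "real \<Rightarrow> real" and h f :: "real \<Rightarrow> complex"
  assumes par: "0 < \<sigma>min" "0 < A" "2 \<le> p"
    and u: "\<And>x. 0 \<le> u x" "in_lp p u" "0 < lp_norm p u"
    and \<kappa>: "\<kappa>1 \<in> Phi \<sigma>min" "\<kappa>2 \<in> Phi \<sigma>min"
    and h: "h C1_differentiable_on UNIV"
    and B: "0 < B" "\<And>t. norm (h t) \<le> B / (1 + \<bar>t\<bar>)"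
      "\<And>t. norm (vector_derivative h (at t)) \<le> B / (1 + t\<^sup>2)"
    and f: "in_lp 2 f" "\<not> (AE x in lborel. f x = 0)"
    and r: "0 < r1" "0 < r2" "\<bar>r2 - r1\<bar> \<le> L * linf_norm (\<lambda>t. \<kappa>2 t - \<kappa>1 t)"
  defines "I \<equiv> 1 + (\<integral>x. (1 / (1 + \<sigma>min * \<bar>x\<bar>))\<^sup>2 \<partial>lborel)"
  defines "M \<equiv> I * (sqrt (linf_norm \<kappa>1 + linf_norm \<kappa>2) * B)" and "K \<equiv> I * (5 / 2 * B / sqrt \<sigma>min)"
  shows "linf_enorm (\<lambda>t. focus_function A h u r2 f \<kappa>2 p t - focus_function A h u r1 f \<kappa>1 p t) \<le>
    ereal (((2 * M * K + L * lp_norm p u) / (min r1 r2 * lp_norm p u) + ((K\<^sup>2 + 4 * M\<^sup>2) / 2 + L) / min r1 r2)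
      * (A * p / (p - 1)) * linf_norm (\<lambda>t. \<kappa>2 t - \<kappa>1 t))"
proof -
  define d where "d = linf_norm (\<lambda>t. \<kappa>2 t - \<kappa>1 t)"
  define k where "k = linf_norm \<kappa>1 + linf_norm \<kappa>2"
  define Q where "Q = (2 * M * K + L * lp_norm p u) / (min r1 r2 * lp_norm p u) + ((K\<^sup>2 + 4 * M\<^sup>2) / 2 + L) / min r1 r2"
  have hc: "continuous_on UNIV h"
    by (rule C1_differentiable_imp_continuous_on[OF h])
  have [measurable]: "h \<in> borel_measurable borel" by (rule borel_measurable_continuous_onI[OF hc])
  have [measurable]: "\<kappa>1 \<in> borel_measurable borel" "\<kappa>2 \<in> borel_measurable borel"
    using \<kappa> by (auto intro: Phi_measurable)
  have [measurable]: "f \<in> borel_measurable borel" "u \<in> borel_measurable borel"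
    using f u by (auto intro: in_lp_measurable)
  have hD: "(h has_vector_derivative vector_derivative h (at t)) (at t)" for t
    using h unfolding C1_differentiable_on_eq by (auto simp: vector_derivative_works)
  have N: "lp_norm 2 f \<noteq> 0" using lp_norm_eq_0D[OF _ f(1)] f(2) by auto
  define g where "g x = of_real (1 / lp_norm 2 f) * f x" for x
  have g: "in_lp 2 g" "lp_norm 2 g = 1"
    unfolding g_def using N lp_norm_nonneg[of 2 f] in_lp_scale[OF f(1), of "of_real (1 / lp_norm 2 f)"]
      lp_norm_scale[of 2 "of_real (1 / lp_norm 2 f) :: complex" f]
    by (simp_all add: norm_divide)
  have [measurable]: "g \<in> borel_measurable borel" by (rule in_lp_measurable[OF g(1)])
  have I1: "1 \<le> I" unfolding I_def by (simp add: integral_nonneg_AE)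
  have kpos: "0 < k" using Phi_linf_norm(2)[OF \<kappa>(1)] Phi_linf_norm(2)[OF \<kappa>(2)] par by (simp add: k_def)
  have M: "M = I * (sqrt k * B)" "0 < M" using I1 kpos B(1) by (auto simp: M_def k_def)
  have K: "0 \<le> K" using I1 par B by (simp add: K_def)
  have d: "0 \<le> d" unfolding d_def by (rule Phi_linf_norm_diff(2)[OF \<kappa>])
  define F where "F \<kappa> t x = g x * cnj (sqrt (\<kappa> t) *\<^sub>R h (\<kappa> t * (x - t)))" for \<kappa> :: "real \<Rightarrow> real" and t x
  have tr: "transform h \<kappa> g t = fourier (F \<kappa> t)" for \<kappa> t
    unfolding F_def by (rule ext) (rule transform_eq_fourier)
  have Fm [measurable]: "F \<kappa> t \<in> borel_measurable borel" for \<kappa> t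
    unfolding F_def[abs_def] by measurable
  \<comment> \<open>The conditions on \<open>t\<close> are available almost everywhere, because
    \<open>linf_norm\<close> is an essential supremum; this matches the essential supremum in the
    conclusion.\<close>
  have diff: "\<bar>focus_function A h u r2 f \<kappa>2 p t - focus_function A h u r1 f \<kappa>1 p t\<bar> \<le> Q * (A * p / (p - 1)) * d"
    if t: "\<bar>\<kappa>2 t - \<kappa>1 t\<bar> \<le> d" "\<kappa>1 t \<le> linf_norm \<kappa>1" "\<kappa>2 t \<le> linf_norm \<kappa>2" for t
  proof -
    have st: "\<sigma>min \<le> \<kappa>1 t" "\<sigma>min \<le> \<kappa>2 t" using \<kappa> by (auto simp: Phi_def)
    have tk: "\<kappa>1 t \<le> k" "\<kappa>2 t \<le> k" using t st par unfolding k_def by linarith+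
    have Fb: "norm (F \<kappa> t x) \<le> (sqrt k * B) * (norm (g x) * (1 / (1 + \<sigma>min * \<bar>x - t\<bar>)))"
      if "\<sigma>min \<le> \<kappa> t" "\<kappa> t \<le> k" for \<kappa> x
    proof -
      have "norm (F \<kappa> t x) = norm (g x) * norm (sqrt (\<kappa> t) *\<^sub>R h (\<kappa> t * (x - t)))"
        by (simp only: F_def norm_mult complex_mod_cnj)
      also have "\<dots> \<le> norm (g x) * (sqrt k * B / (1 + \<sigma>min * \<bar>x - t\<bar>))"
        using B(1) by (intro mult_left_mono window_bound[OF B(2) par(1) that]) auto
      finally show ?thesis by (simp add: mult_ac)
    qed
    have Fd: "norm (F \<kappa>2 t x - F \<kappa>1 t x) \<le> (5 / 2 * B / sqrt \<sigma>min * d) * (norm (g x) * (1 / (1 + \<sigma>min * \<bar>x - t\<bar>)))" for x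
    proof -
      have "norm (F \<kappa>2 t x - F \<kappa>1 t x) = norm (g x) *
          norm (sqrt (\<kappa>2 t) *\<^sub>R h (\<kappa>2 t * (x - t)) - sqrt (\<kappa>1 t) *\<^sub>R h (\<kappa>1 t * (x - t)))"
        by (simp only: F_def norm_mult complex_mod_cnj right_diff_distrib[symmetric] complex_cnj_diff[symmetric])
      also have "\<dots> \<le> norm (g x) * (5 / 2 * B / sqrt \<sigma>min * \<bar>\<kappa>2 t - \<kappa>1 t\<bar> / (1 + \<sigma>min * \<bar>x - t\<bar>))"
        using B(1) by (intro mult_left_mono window_lipschitz[OF hD B(2,3) par(1) st]) auto
      also have "\<dots> \<le> norm (g x) * (5 / 2 * B / sqrt \<sigma>min * d / (1 + \<sigma>min * \<bar>x - t\<bar>))"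
        using B(1) par t(1) by (intro mult_left_mono divide_right_mono) (auto intro: add_nonneg_nonneg)
      finally show ?thesis by (simp add: mult_ac)
    qed
    have c: "0 \<le> sqrt k * B" "0 \<le> 5 / 2 * B / sqrt \<sigma>min * d" using kpos B(1) par d by auto
    note b1 = fourier_decay_bound[OF g par(1) c(1) Fm Fb[of \<kappa>1, OF st(1) tk(1)], folded I_def M(1)]
    note b2 = fourier_decay_bound[OF g par(1) c(1) Fm Fb[of \<kappa>2, OF st(2) tk(2)], folded I_def M(1)]
    have FF: "fourier (F \<kappa>2 t) \<omega> - fourier (F \<kappa>1 t) \<omega> = fourier (\<lambda>x. F \<kappa>2 t x - F \<kappa>1 t x) \<omega>" for \<omega>
      by (rule fourier_diff[OF b2(1) b1(1), symmetric])
    have Kd: "I * (5 / 2 * B / sqrt \<sigma>min * d) = K * d" by (simp add: K_def)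
    have Fdm: "(\<lambda>x. F \<kappa>2 t x - F \<kappa>1 t x) \<in> borel_measurable borel" by measurable
    note bd = fourier_decay_bound[OF g par(1) c(2) Fdm Fd, folded I_def FF, unfolded Kd]
    let ?X = "\<lambda>\<kappa> r. lp_norm p (\<lambda>\<omega>. ((norm (fourier (F \<kappa> t) \<omega>))\<^sup>2 + r * u \<omega>) / ((\<integral>\<omega>. (norm (fourier (F \<kappa> t) \<omega>))\<^sup>2 \<partial>lborel) + r))"
    have main: "\<bar>ln (?X \<kappa>2 r2) - ln (?X \<kappa>1 r1)\<bar> \<le> Q * d"
      unfolding Q_def
    proof (rule regularized_density_lipschitz[OF par(3) u _ _ b2(2-4) b1(2-4) bd(2-4)])
      show "fourier (F \<kappa>2 t) \<in> borel_measurable borel" "fourier (F \<kappa>1 t) \<in> borel_measurable borel"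
        by measurable
      show "0 < min r1 r2" "min r1 r2 \<le> r2" "min r1 r2 \<le> r1" using r by auto
      show "\<bar>r2 - r1\<bar> \<le> L * d" using r(3) by (simp add: d_def)
    qed (rule d K M(2))+
    have rho: "lp_norm p (rho h u r f \<kappa> t) = ?X \<kappa> r" for \<kappa> r
    proof -
      have "rho h u r f \<kappa> t = (\<lambda>\<omega>. ((norm (fourier (F \<kappa> t) \<omega>))\<^sup>2 + r * u \<omega>) / ((\<integral>\<omega>. (norm (fourier (F \<kappa> t) \<omega>))\<^sup>2 \<partial>lborel) + r))"
        by (rule ext) (rule rho_normalize[OF N, of h u r \<kappa> t, folded g_def, unfolded tr])
      then show ?thesis by (rule arg_cong)
    qed
    \<comment> \<open>The constant 1 and the term with \<open>ln (lp_norm p u)\<close> cancel in the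
      difference; |p / (1 - p)| = p / (p - 1) then gives the prefactor.\<close>
    have alg: "(1 + A * (c * x - z)) - (1 + A * (c * y - z)) = A * c * (x - y)" for c x y z :: real
      by (simp add: algebra_simps)
    have p: "p \<noteq> 0" using par(3) by simp
    have "focus_function A h u r2 f \<kappa>2 p t - focus_function A h u r1 f \<kappa>1 p t =
        A * (p / (1 - p)) * (ln (?X \<kappa>2 r2) - ln (?X \<kappa>1 r1))"
      unfolding focus_function_def renyi_entropy_eq[OF p] rho by (rule alg)
    moreover have "\<bar>A * (p / (1 - p)) * x\<bar> \<le> Q * (A * p / (p - 1)) * d" if "\<bar>x\<bar> \<le> Q * d" for x
    proof -
      have "\<bar>A * (p / (1 - p)) * x\<bar> = A * p / (p - 1) * \<bar>x\<bar>" using par by (simp add: abs_mult)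
      also have "\<dots> \<le> A * p / (p - 1) * (Q * d)" using par by (intro mult_left_mono that) simp
      finally show ?thesis by (simp add: mult_ac)
    qed
    ultimately show ?thesis using main by (simp only:)
  qed
  have "AE t in lborel. \<bar>focus_function A h u r2 f \<kappa>2 p t - focus_function A h u r1 f \<kappa>1 p t\<bar> \<le> Q * (A * p / (p - 1)) * d"
    using Phi_linf_norm_diff(1)[OF \<kappa>] Phi_linf_norm(1)[OF \<kappa>(1)] Phi_linf_norm(1)[OF \<kappa>(2)]
    by eventually_elim (rule diff, auto simp: d_def)
  then show ?thesis
    unfolding linf_enorm_def Q_def[symmetric] d_def[symmetric] by (intro esssup_I) auto
qed

text \<open>Quantifying \<open>C3\<close> before everything except \<open>\<sigma>min\<close> and
  \<open>A\<close> expresses which quantities it may depend on; whatever else the estimate uses must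
  be recomputed from its five arguments.\<close>

theorem theorem2:
  fixes \<sigma>min A :: real
  assumes "0 < \<sigma>min" and "\<sigma>min < 1" and "0 < A"
  shows "\<exists>C3 :: real \<Rightarrow> real \<Rightarrow> real \<Rightarrow> (real \<Rightarrow> complex) \<Rightarrow> real \<Rightarrow> real.
    \<forall>(p :: real) (u :: real \<Rightarrow> real) (\<kappa>1 :: real \<Rightarrow> real) (\<kappa>2 :: real \<Rightarrow> real)
      (h :: real \<Rightarrow> complex) (\<psi> :: real \<Rightarrow> real) (\<phi> :: real \<Rightarrow> real) (f :: real \<Rightarrow> complex).
      2 \<le> p \<longrightarrow>
      smooth u \<longrightarrow> (\<forall>x. 0 \<le> u x) \<longrightarrow> has_bochner_integral lborel u 1 \<longrightarrow> in_lp p u \<longrightarrow>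
      \<kappa>1 \<in> Phi \<sigma>min \<longrightarrow> \<kappa>2 \<in> Phi \<sigma>min \<longrightarrow>
      h C1_differentiable_on UNIV \<longrightarrow> (\<exists>t. h t \<noteq> 0) \<longrightarrow>
      continuous_on UNIV \<psi> \<longrightarrow> (\<forall>t. 0 \<le> \<psi> t) \<longrightarrow> bounded (range \<psi>) \<longrightarrow>
      continuous_on UNIV \<phi> \<longrightarrow> (\<forall>t. 0 \<le> \<phi> t) \<longrightarrow> bounded (range \<phi>) \<longrightarrow>
      (\<forall>t. norm (h t) \<le> \<psi> t / (1 + \<bar>t\<bar>)) \<longrightarrow>
      (\<forall>t. norm (vector_derivative h (at t)) \<le> \<phi> t / (1 + t\<^sup>2)) \<longrightarrow>
      in_lp 2 f \<longrightarrow> \<not> (AE x in lborel. f x = 0) \<longrightarrow>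
      linf_enorm (\<lambda>t. focus_function A h u (r_min \<sigma>min A h u p \<kappa>2) f \<kappa>2 p t -
                      focus_function A h u (r_min \<sigma>min A h u p \<kappa>1) f \<kappa>1 p t)
      \<le> ereal (C3 p (linf_norm \<kappa>1) (linf_norm \<kappa>2) h (lp_norm p u) *
               (A * p / (p - 1)) * linf_norm (\<lambda>t. \<kappa>2 t - \<kappa>1 t))"
proof -
  \<comment> \<open>The decay bounds \<open>\<psi>\<close>, \<open>\<phi>\<close> are not parameters of the constant, so a bound is chosen from \<open>h\<close> alone.\<close>
  define P where "P h B \<longleftrightarrow> 0 < B \<and> (\<forall>t. norm (h t) \<le> B / (1 + \<bar>t\<bar>)) \<and>
    (\<forall>t. norm (vector_derivative h (at t)) \<le> B / (1 + t\<^sup>2))" for h :: "real \<Rightarrow> complex" and B :: real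
  define bnd where "bnd h = (SOME B. P h B)" for h
  \<comment> \<open>This is \<open>r_min\<close> with numbers \<open>k\<close>, \<open>U\<close> in
    place of the norms of the reference and of \<open>u\<close>, so that it can occur inside the
    constant.\<close>
  define \<rho> where "\<rho> p k h U = A * p / ((p - 1) * (1 - \<sigma>min)) *
     (k powr (1 - 1 / p) * linf_norm h powr (2 / p) * lp_norm 2 h powr (2 - 2 / p) / U)"
    for p k U and h :: "real \<Rightarrow> complex"
  define I where "I = 1 + (\<integral>x. (1 / (1 + \<sigma>min * \<bar>x\<bar>))\<^sup>2 \<partial>lborel)"
  define M where "M k1 k2 h = I * (sqrt (k1 + k2) * bnd h)" for k1 k2 h
  define K where "K h = I * (5 / 2 * bnd h / sqrt \<sigma>min)" for h
  \<comment> \<open>Difference quotient of \<open>r_min\<close>; for \<open>k1 = k2\<close> the junk value \<open>x / 0 = 0\<close> is the right one.\<close>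
  define L where "L p k1 k2 h U = \<bar>\<rho> p k2 h U - \<rho> p k1 h U\<bar> / \<bar>k2 - k1\<bar>" for p k1 k2 U h
  define C where "C p k1 k2 h U =
    (2 * M k1 k2 h * K h + L p k1 k2 h U * U) / (min (\<rho> p k1 h U) (\<rho> p k2 h U) * U)
      + (((K h)\<^sup>2 + 4 * (M k1 k2 h)\<^sup>2) / 2 + L p k1 k2 h U) / min (\<rho> p k1 h U) (\<rho> p k2 h U)"
    for p k1 k2 U h
  show ?thesis
  proof (rule exI[of _ C]; (intro allI impI)?)
    fix p :: real and u \<kappa>1 \<kappa>2 \<psi> \<phi> :: "real \<Rightarrow> real" and h f :: "real \<Rightarrow> complex"
    assume p: "2 \<le> p" and u: "\<forall>x. 0 \<le> u x" "has_bochner_integral lborel u 1" "in_lp p u"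
      and \<kappa>: "\<kappa>1 \<in> Phi \<sigma>min" "\<kappa>2 \<in> Phi \<sigma>min"
      and h: "h C1_differentiable_on UNIV" "\<exists>t. h t \<noteq> 0"
      and \<psi>: "bounded (range \<psi>)" and \<phi>: "bounded (range \<phi>)"
      and h\<psi>: "\<forall>t. norm (h t) \<le> \<psi> t / (1 + \<bar>t\<bar>)"
      and h\<phi>: "\<forall>t. norm (vector_derivative h (at t)) \<le> \<phi> t / (1 + t\<^sup>2)"
      and f: "in_lp 2 f" "\<not> (AE x in lborel. f x = 0)"
    obtain b1 b2 where b: "\<And>t. \<psi> t \<le> b1" "\<And>t. \<phi> t \<le> b2"
      using \<psi> \<phi> unfolding bounded_iff by (metis abs_le_D1 rangeI real_norm_def)
    \<comment> \<open>One number for both decay conditions; the 1 makes it positive.\<close>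
    have "P h (max 1 (max b1 b2))"
    proof -
      have "\<psi> t \<le> max 1 (max b1 b2)" "\<phi> t \<le> max 1 (max b1 b2)" for t
        using b[of t] by auto
      then show ?thesis
        unfolding P_def
        using order_trans[OF h\<psi>[rule_format] divide_right_mono] order_trans[OF h\<phi>[rule_format] divide_right_mono]
        by (auto simp del: max.bounded_iff le_max_iff_disj)
    qed
    then have "P h (bnd h)" unfolding bnd_def by (rule someI)
    then have B: "0 < bnd h" "\<And>t. norm (h t) \<le> bnd h / (1 + \<bar>t\<bar>)"
        "\<And>t. norm (vector_derivative h (at t)) \<le> bnd h / (1 + t\<^sup>2)"
      by (auto simp: P_def)
    have U: "0 < lp_norm p u"
    proof -
      have "lp_norm p u \<noteq> 0"
      proof
        assume "lp_norm p u = 0"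
        then have "AE x in lborel. u x = 0" using lp_norm_eq_0D[OF _ u(3)] p by simp
        then have "(\<integral>x. u x \<partial>lborel) = 0" by (rule integral_eq_zero_AE)
        then show False using has_bochner_integral_integral_eq[OF u(2)] by simp
      qed
      then show ?thesis by (simp add: less_le)
    qed
    obtain t0 where t0: "h t0 \<noteq> 0" using h(2) by blast
    note hpos = window_norms_pos[OF C1_differentiable_imp_continuous_on[OF h(1)] t0 B(2)]
    have rmin: "r_min \<sigma>min A h u p \<kappa> = \<rho> p (linf_norm \<kappa>) h (lp_norm p u)" for \<kappa>
      by (simp add: r_min_def \<rho>_def)
    have \<rho>pos: "0 < \<rho> p (linf_norm \<kappa>) h (lp_norm p u)" if "\<kappa> \<in> Phi \<sigma>min" for \<kappa>
      using assms p U hpos Phi_linf_norm(2)[OF that] unfolding \<rho>_def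
      by (intro mult_pos_pos divide_pos_pos) auto
    \<comment> \<open>The quotient times its denominator recovers the change of
      \<open>r_min\<close>, and the denominator is at most the norm of the difference of the
      references.\<close>
    have Lb: "\<bar>\<rho> p (linf_norm \<kappa>2) h (lp_norm p u) - \<rho> p (linf_norm \<kappa>1) h (lp_norm p u)\<bar>
      \<le> L p (linf_norm \<kappa>1) (linf_norm \<kappa>2) h (lp_norm p u) * linf_norm (\<lambda>t. \<kappa>2 t - \<kappa>1 t)"
    proof -
      have "\<bar>\<rho> p (linf_norm \<kappa>2) h (lp_norm p u) - \<rho> p (linf_norm \<kappa>1) h (lp_norm p u)\<bar> =
        L p (linf_norm \<kappa>1) (linf_norm \<kappa>2) h (lp_norm p u) * \<bar>linf_norm \<kappa>2 - linf_norm \<kappa>1\<bar>"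
        by (cases "linf_norm \<kappa>2 = linf_norm \<kappa>1") (auto simp: L_def)
      also have "\<dots> \<le> L p (linf_norm \<kappa>1) (linf_norm \<kappa>2) h (lp_norm p u) * linf_norm (\<lambda>t. \<kappa>2 t - \<kappa>1 t)"
        by (intro mult_left_mono Phi_linf_norm_diff(3)[OF \<kappa>]) (simp add: L_def)
      finally show ?thesis .
    qed
    show "linf_enorm (\<lambda>t. focus_function A h u (r_min \<sigma>min A h u p \<kappa>2) f \<kappa>2 p t -
                      focus_function A h u (r_min \<sigma>min A h u p \<kappa>1) f \<kappa>1 p t)
      \<le> ereal (C p (linf_norm \<kappa>1) (linf_norm \<kappa>2) h (lp_norm p u) *
               (A * p / (p - 1)) * linf_norm (\<lambda>t. \<kappa>2 t - \<kappa>1 t))"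
      using focus_function_lipschitz[OF assms(1,3) p _ u(3) U \<kappa> h(1) B f \<rho>pos[OF \<kappa>(1)] \<rho>pos[OF \<kappa>(2)] Lb] u(1)
      unfolding rmin C_def M_def K_def I_def by blast
  qed
qed

end
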